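(* Let $M$ be the Heisenberg $3$-manifold, with minimal model $\Lambda(\hat x,\hat y,\hat w)$ over $\mathbb{Q}$, where $\hat x,\hat y,\hat w$ have degree one, $d\hat x=d\hat y=0$ and $d\hat w=\hat x\wedge\hat y$, and let $x,y\in H^1(M;\mathbb{Q})$ be the cohomology classes of $\hat x,\hat y$. For any two elements $x_0,y_0\in H^1(M;\mathbb{Q})$, let $A=\begin{pmatrix} a & b\\ c& d\end{pmatrix}$ be the rational matrix expressing these classes in terms of the basis $x,y$, i.e. $x_0=ax+by$ and $y_0=cx+dy$. Let $\langle\langle x_0,y_0\rangle\rangle\in H^3(M;\mathbb{Q})$ be the cohomology class of $\hat x_0\wedge\hat y_0\wedge\hat w_0$, where $\hat x_0,\hat y_0$ are $1$-cocycles of the minimal model representing $x_0,y_0$, and $\hat w_0$ is a degree one element with $d\hat w_0=\hat x_0\wedge\hat y_0$. Then $$\langle\langle x_0,y_0\rangle\rangle=(\det A)^2\,\langle\langle x,y\rangle\rangle ,$$ where $\langle\langle x,y\rangle\rangle$ is the class of $\hat x\wedge\hat y\wedge\hat w$. Hence the pairing $\langle\langle\cdot,\cdot\rangle\rangle: H^1(M;\mathbb{Q})\times H^1(M;\mathbb{Q})\to H^3(M;\mathbb{Q})$ is well-defined (the class $\langle\langle x_0,y_0\rangle\rangle$ does not depend on the choices of $\hat x_0,\hat y_0,\hat w_0$), and the canonical orientation of $M$ can be determined from any basis for $H^1(M;\mathbb{Q})$: for every basis $x_0,y_0$ of $H^1(M;\mathbb{Q})$, the canonical orientation is the orientation of $M$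 whose associated generator $[M]^\ast\in H^3(M;\mathbb{Q})$ satisfies $\langle\langle x_0,y_0\rangle\rangle=r\,[M]^\ast$ with $r\in\mathbb{Q}$, $r>0$.
   Context: The Heisenberg $3$-manifold $M$ is the closed $3$-dimensional nilmanifold obtained as the quotient of the group of real upper unitriangular $3\times 3$ matrices by the subgroup of integer ones. Its (rational, Sullivan) minimal model is the free graded-commutative differential graded algebra $\Lambda(\hat x,\hat y,\hat w)$ over $\mathbb{Q}$ on three generators of degree one (an exterior algebra, with product written $\wedge$), with $d\hat x=d\hat y=0$ and $d\hat w=\hat x\wedge\hat y$. Its cohomology is identified with $H^\ast(M;\mathbb{Q})$. The elements $\hat x,\hat y$ form a basis of the $1$-cocycles, and the corresponding cohomology classes $x,y$ form a basis of $H^1(M;\mathbb{Q})$. The class of $\hat x\wedge\hat y\wedge\hat w$ generates $H^3(M;\mathbb{Q})\cong\mathbb{Q}$. An orientation of $M$ determines a generator $[M]^\ast\in H^3(M;\mathbb{Q})$ (the class evaluating to $1$ on the fundamental class). The canonical orientation of $M$ is the orientation for which the class of $\hat x\wedge\hat y\wedge\hat w$ equals $r\,[M]^\ast$ with $r>0$. Definition of the pairing: given $x_0,y_0\in H^1(M;\mathbb{Q})$, choose $1$-cocycles $\hat x_0,\hat y_0$ in the minimal model with cohomology classes $x_0,y_0$. Since $x_0\cup y_0=0$ in $H^2(M;\mathbb{Q})$, there exists a degree one element $\hat w_0$ of the minimal model with $d\hat w_0=\hat x_0\wedge\hat y_0$. Then $\langle\langle x_0,y_0\rangle\rangle\in H^3(M;\mathbb{Q})$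 is the cohomology class of $\hat x_0\wedge\hat y_0\wedge\hat w_0$. *)

theory Defs
  imports "HOL-Homology.Homology" "HOL-Analysis.Determinants" "HOL-Library.Function_Algebras"
begin

section \<open>Differential graded algebras over the rationals\<close>

text \<open>
  A differential graded algebra is given by its homogeneous components inside an ambient
  rational vector space; the axioms below only constrain the operations on homogeneous elements.
\<close>

record 'a dga =
  component :: "nat \<Rightarrow> 'a set"
  scale :: "rat \<Rightarrow> 'a \<Rightarrow> 'a"
  mult :: "'a \<Rightarrow> 'a \<Rightarrow> 'a"
  unit :: "'a"
  diff :: "'a \<Rightarrow> 'a"

definition is_dga :: "'a::ab_group_add dga \<Rightarrow> bool" where
  "is_dga A \<longleftrightarrow>
     vector_space (scale A) \<and>
     (\<forall>n. module.subspace (scale A) (component A n)) \<and>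
     unit A \<in> component A 0 \<and>
     (\<forall>n. \<forall>a\<in>component A n. mult A (unit A) a = a \<and> mult A a (unit A) = a) \<and>
     (\<forall>p q. \<forall>a\<in>component A p. \<forall>b\<in>component A q. mult A a b \<in> component A (p + q)) \<and>
     (\<forall>p q. \<forall>a\<in>component A p. \<forall>a'\<in>component A p. \<forall>b\<in>component A q.
        mult A (a + a') b = mult A a b + mult A a' b) \<and>
     (\<forall>p q. \<forall>a\<in>component A p. \<forall>b\<in>component A q. \<forall>b'\<in>component A q.
        mult A a (b + b') = mult A a b + mult A a b') \<and>
     (\<forall>p q r. \<forall>a\<in>component A p. \<forall>b\<in>component A q.
        mult A (scale A r a) b = scale A r (mult A a b) \<and>
        mult A a (scale A r b) = scale A r (mult A a b)) \<and>
     (\<forall>p q r. \<forall>a\<in>component A p. \<forall>b\<in>component A q. \<forall>c\<in>component A r.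
        mult A (mult A a b) c = mult A a (mult A b c)) \<and>
     (\<forall>n. \<forall>a\<in>component A n. diff A a \<in> component A (Suc n) \<and> diff A (diff A a) = 0) \<and>
     (\<forall>n. \<forall>a\<in>component A n. \<forall>b\<in>component A n. diff A (a + b) = diff A a + diff A b) \<and>
     (\<forall>n r. \<forall>a\<in>component A n. diff A (scale A r a) = scale A r (diff A a)) \<and>
     (\<forall>p q. \<forall>a\<in>component A p. \<forall>b\<in>component A q.
        diff A (mult A a b) = mult A (diff A a) b + scale A ((-1) ^ p) (mult A a (diff A b)))"

definition cocycles :: "'a::ab_group_add dga \<Rightarrow> nat \<Rightarrow> 'a set" where
  "cocycles A n = {z \<in> component A n. diff A z = 0}"

definition coboundaries :: "'a::ab_group_add dga \<Rightarrow> nat \<Rightarrow> 'a set" where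
  "coboundaries A n = (if n = 0 then {0} else diff A ` component A (n - 1))"

definition cohomology_class :: "'a::ab_group_add dga \<Rightarrow> nat \<Rightarrow> 'a \<Rightarrow> 'a set" where
  "cohomology_class A n z = (\<lambda>b. z + b) ` coboundaries A n"

definition cohomology :: "'a::ab_group_add dga \<Rightarrow> nat \<Rightarrow> 'a set set" where
  "cohomology A n = cohomology_class A n ` cocycles A n"

text \<open>Vector space structure of the cohomology, computed on representatives.\<close>

definition class_add :: "'a::ab_group_add dga \<Rightarrow> nat \<Rightarrow> 'a set \<Rightarrow> 'a set \<Rightarrow> 'a set" where
  "class_add A n u v = (\<Union>a\<in>u. \<Union>b\<in>v. cohomology_class A n (a + b))"

definition class_scale :: "'a::ab_group_add dga \<Rightarrow> nat \<Rightarrow> rat \<Rightarrow> 'a set \<Rightarrow> 'a set" where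
  "class_scale A n r u = (\<Union>a\<in>u. cohomology_class A n (scale A r a))"

definition class_basis2 :: "'a::ab_group_add dga \<Rightarrow> nat \<Rightarrow> 'a set \<Rightarrow> 'a set \<Rightarrow> bool" where
  "class_basis2 A n u v \<longleftrightarrow>
     u \<in> cohomology A n \<and> v \<in> cohomology A n \<and>
     (\<forall>w\<in>cohomology A n. \<exists>!(r, s). w = class_add A n (class_scale A n r u) (class_scale A n s v))"

definition dga_hom :: "'a::ab_group_add dga \<Rightarrow> 'b::ab_group_add dga \<Rightarrow> ('a \<Rightarrow> 'b) \<Rightarrow> bool" where
  "dga_hom A B f \<longleftrightarrow>
     (\<forall>n. \<forall>a\<in>component A n. f a \<in> component B n \<and> f (diff A a) = diff B (f a)) \<and>
     (\<forall>n. \<forall>a\<in>component A n. \<forall>b\<in>component A n. f (a + b) = f a + f b) \<and>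
     (\<forall>n r. \<forall>a\<in>component A n. f (scale A r a) = scale B r (f a)) \<and>
     f (unit A) = unit B \<and>
     (\<forall>p q. \<forall>a\<in>component A p. \<forall>b\<in>component A q. f (mult A a b) = mult B (f a) (f b))"

definition cohomology_map :: "'b::ab_group_add dga \<Rightarrow> ('a \<Rightarrow> 'b) \<Rightarrow> nat \<Rightarrow> 'a set \<Rightarrow> 'b set" where
  "cohomology_map B f n u = (\<Union>a\<in>u. cohomology_class B n (f a))"

definition quasi_iso :: "'a::ab_group_add dga \<Rightarrow> 'b::ab_group_add dga \<Rightarrow> ('a \<Rightarrow> 'b) \<Rightarrow> bool" where
  "quasi_iso A B f \<longleftrightarrow> dga_hom A B f \<and>
     (\<forall>n. bij_betw (cohomology_map B f n) (cohomology A n) (cohomology B n))"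

section \<open>Rational singular cochains and the fundamental class\<close>

text \<open>
  Values of a rational function on singular simplices, extended additively to integral singular chains.
\<close>

definition chain_eval :: "(((nat \<Rightarrow> real) \<Rightarrow> 'x) \<Rightarrow> rat) \<Rightarrow> 'x chain \<Rightarrow> rat" where
  "chain_eval f c = (\<Sum>\<sigma>\<in>Poly_Mapping.keys c. of_int (Poly_Mapping.lookup c \<sigma>) * f \<sigma>)"

definition front_face :: "nat \<Rightarrow> ((nat \<Rightarrow> real) \<Rightarrow> 'x) \<Rightarrow> (nat \<Rightarrow> real) \<Rightarrow> 'x" where
  "front_face p \<sigma> = restrict \<sigma> (standard_simplex p)"

text \<open>The face spanned by the vertices \<open>p, \<dots>, p + q\<close>, as a singular \<open>q\<close>-simplex.\<close>

definition back_face :: "nat \<Rightarrow> nat \<Rightarrow> ((nat \<Rightarrow> real) \<Rightarrow> 'x) \<Rightarrow> (nat \<Rightarrow> real) \<Rightarrow> 'x" where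
  "back_face p q \<sigma> =
     restrict (\<lambda>t. \<sigma> (\<lambda>i. if i < p then 0 else t (i - p))) (standard_simplex q)"

text \<open>
  A cochain \<open>f\<close> has the part \<open>f n\<close> in degree \<open>n\<close>; it is normalised to vanish outside the singular
  \<open>n\<close>-simplices of the space. The product is the cup product, and the differential is the
  (unsigned) transpose of the boundary.
\<close>

definition singular_cochains ::
    "'x topology \<Rightarrow> (nat \<Rightarrow> ((nat \<Rightarrow> real) \<Rightarrow> 'x) \<Rightarrow> rat) dga" where
  "singular_cochains X =
     \<lparr>component = (\<lambda>n. {f. \<forall>m \<sigma>. f m \<sigma> \<noteq> 0 \<longrightarrow> m = n \<and> singular_simplex n X \<sigma>}),
      scale = (\<lambda>r f n \<sigma>. r * f n \<sigma>),
      mult = (\<lambda>f g n \<sigma>. if singular_simplex n X \<sigma>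
                then \<Sum>p\<le>n. f p (front_face p \<sigma>) * g (n - p) (back_face p (n - p) \<sigma>) else 0),
      unit = (\<lambda>n \<sigma>. if n = 0 \<and> singular_simplex 0 X \<sigma> then 1 else 0),
      diff = (\<lambda>f n \<sigma>. if n > 0 \<and> singular_simplex n X \<sigma>
                then chain_eval (f (n - 1)) (chain_boundary n (frag_of \<sigma>)) else 0)\<rparr>"

text \<open>
  Kronecker pairing of a rational cohomology class with an integral homology class
  (an element of the library's \<^term>\<open>homology_group\<close>, i.e. a set of homologous cycles).
\<close>

definition kronecker ::
    "nat \<Rightarrow> (nat \<Rightarrow> ((nat \<Rightarrow> real) \<Rightarrow> 'x) \<Rightarrow> rat) set \<Rightarrow> 'x chain set \<Rightarrow> rat" where
  "kronecker n u \<mu> = (THE r. \<forall>f\<in>u. \<forall>z\<in>\<mu>. chain_eval (f n) z = r)"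

text \<open>
  An orientation of a closed connected orientable 3-manifold \<open>X\<close> is encoded by its fundamental
  class, one of the two generators of the infinite cyclic group \<open>H\<^sub>3(X; \<int>)\<close>.
\<close>

definition orientation3 :: "'x topology \<Rightarrow> 'x chain set \<Rightarrow> bool" where
  "orientation3 X \<mu> \<longleftrightarrow>
     \<mu> \<in> carrier (homology_group 3 X) \<and>
     carrier (subgroup_generated (homology_group 3 X) {\<mu>}) = carrier (homology_group 3 X)"

text \<open>The class \<open>[X]\<^sup>*\<close> evaluating to 1 on the fundamental class.\<close>

definition dual_class3 ::
    "'x topology \<Rightarrow> 'x chain set \<Rightarrow> (nat \<Rightarrow> ((nat \<Rightarrow> real) \<Rightarrow> 'x) \<Rightarrow> rat) set" where
  "dual_class3 X \<mu> =
     (THE g. g \<in> cohomology (singular_cochains X) 3 \<and> kronecker 3 g \<mu> = 1)"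

section \<open>The Heisenberg manifold\<close>

definition heis_group :: "(real^3^3) set" where
  "heis_group = {U. U$1$1 = 1 \<and> U$2$2 = 1 \<and> U$3$3 = 1 \<and> U$2$1 = 0 \<and> U$3$1 = 0 \<and> U$3$2 = 0}"

definition heis_lattice :: "(real^3^3) set" where
  "heis_lattice = {U \<in> heis_group. \<forall>i j. U$i$j \<in> \<int>}"

definition heis_coset :: "real^3^3 \<Rightarrow> (real^3^3) set" where
  "heis_coset U = (\<lambda>N. U ** N) ` heis_lattice"

definition heis_manifold :: "(real^3^3) set topology" where
  "heis_manifold =
     topology (\<lambda>V. V \<subseteq> heis_coset ` heis_group \<and>
                   openin (top_of_set heis_group) {U \<in> heis_group. heis_coset U \<in> V})"

lemma openin_heis_manifold:
  "openin heis_manifold V \<longleftrightarrow>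
     V \<subseteq> heis_coset ` heis_group \<and>
     openin (top_of_set heis_group) {U \<in> heis_group. heis_coset U \<in> V}"
proof -
  let ?inv = "\<lambda>V. {U \<in> heis_group. heis_coset U \<in> V}"
  have Int: "?inv (S \<inter> T) = ?inv S \<inter> ?inv T" for S T by blast
  have Union: "?inv (\<Union>K) = \<Union> (?inv ` K)" for K by blast
  have "istopology (\<lambda>V. V \<subseteq> heis_coset ` heis_group \<and> openin (top_of_set heis_group) (?inv V))"
    unfolding istopology_def Int Union
    by (intro conjI allI impI openin_Int openin_Union) blast+
  then show ?thesis by (simp add: heis_manifold_def)
qed

lemma topspace_heis_manifold: "topspace heis_manifold = heis_coset ` heis_group"
proof (rule subset_antisym)
  show "topspace heis_manifold \<subseteq> heis_coset ` heis_group"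
    using openin_topspace[of heis_manifold] unfolding openin_heis_manifold by (rule conjunct1)
  have "{U \<in> heis_group. heis_coset U \<in> heis_coset ` heis_group} = heis_group" by blast
  then have "openin heis_manifold (heis_coset ` heis_group)"
    unfolding openin_heis_manifold by simp
  then show "heis_coset ` heis_group \<subseteq> topspace heis_manifold" by (rule openin_subset)
qed

lemma quotient_map_heis_coset: "quotient_map (top_of_set heis_group) heis_manifold heis_coset"
  by (simp add: quotient_map_def topspace_heis_manifold openin_heis_manifold)

section \<open>The minimal model\<close>

datatype heis_gen = GX | GY | GW

primrec heis_index :: "heis_gen \<Rightarrow> nat" where
  "heis_index GX = 0" | "heis_index GY = 1" | "heis_index GW = 2"

text \<open>
  Elements of the exterior algebra are given by their coefficients with respect to the monomials
  \<open>e\<^sub>S\<close>, the products of the generators in \<open>S\<close> in increasing order;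
  \<open>e\<^sub>S \<and> e\<^sub>T\<close> equals \<open>wedge_sign S T\<close> times \<open>e\<^bsub>S \<union> T\<^esub>\<close> if \<open>S\<close> and \<open>T\<close> are disjoint, and 0 otherwise.
\<close>

definition wedge_sign :: "heis_gen set \<Rightarrow> heis_gen set \<Rightarrow> rat" where
  "wedge_sign S T = (-1) ^ card {(s, t) \<in> S \<times> T. heis_index t < heis_index s}"

definition monomial :: "heis_gen set \<Rightarrow> heis_gen set \<Rightarrow> rat" where
  "monomial S = (\<lambda>T. if T = S then 1 else 0)"

text \<open>
  The derivation with \<open>d x = d y = 0\<close> and \<open>d w = x \<and> y\<close> vanishes on all monomials
  other than \<open>w\<close>, since by the Leibniz rule
  every other \<open>d e\<^sub>S\<close> is 0 or has a repeated factor \<open>x\<close> or \<open>y\<close>.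
\<close>

definition heis_model :: "(heis_gen set \<Rightarrow> rat) dga" where
  "heis_model =
     \<lparr>component = (\<lambda>n. {a. \<forall>S. a S \<noteq> 0 \<longrightarrow> card S = n}),
      scale = (\<lambda>r a S. r * a S),
      mult = (\<lambda>a b U. \<Sum>S\<in>Pow U. wedge_sign S (U - S) * a S * b (U - S)),
      unit = monomial {},
      diff = (\<lambda>a U. if U = {GX, GY} then a {GW} else 0)\<rparr>"

abbreviation wedge :: "(heis_gen set \<Rightarrow> rat) \<Rightarrow> (heis_gen set \<Rightarrow> rat) \<Rightarrow> heis_gen set \<Rightarrow> rat"
    (infixr \<open>\<and>\<^sub>m\<close> 70) where
  "a \<and>\<^sub>m b \<equiv> mult heis_model a b"

abbreviation model_x :: "heis_gen set \<Rightarrow> rat" where "model_x \<equiv> monomial {GX}"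
abbreviation model_y :: "heis_gen set \<Rightarrow> rat" where "model_y \<equiv> monomial {GY}"
abbreviation model_w :: "heis_gen set \<Rightarrow> rat" where "model_w \<equiv> monomial {GW}"

lemma heis_gen_UNIV: "(UNIV :: heis_gen set) = {GX, GY, GW}"
  using heis_gen.exhaust by blast

lemma finite_heis_gen_set: "finite (S :: heis_gen set)"
  by (rule finite_subset[OF subset_UNIV]) (simp add: heis_gen_UNIV)

lemma heis_gen_all_sets:
  "(\<forall>S :: heis_gen set. P S) \<longleftrightarrow> P {} \<and> P {GX} \<and> P {GY} \<and> P {GW} \<and>
     P {GX, GY} \<and> P {GX, GW} \<and> P {GY, GW} \<and> P {GX, GY, GW}"
proof -
  have "(UNIV :: heis_gen set set) =
      {{}, {GX}, {GY}, {GW}, {GX, GY}, {GX, GW}, {GY, GW}, {GX, GY, GW}}"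
    by (subst Pow_UNIV[symmetric]) (auto simp: heis_gen_UNIV Pow_insert)
  then show ?thesis by (metis UNIV_I insert_iff empty_iff)
qed

lemma heis_elt_eq_iff: "(f :: heis_gen set \<Rightarrow> rat) = g \<longleftrightarrow> (\<forall>S. f S = g S)"
  by auto

lemma wedge_sign_prod:
  "wedge_sign A B = (\<Prod>s\<in>A. \<Prod>t\<in>B. if heis_index t < heis_index s then -1 else 1)"
proof -
  have "(\<Prod>s\<in>A. \<Prod>t\<in>B. if heis_index t < heis_index s then -1 else (1::rat)) =
      (\<Prod>p\<in>A \<times> B. if heis_index (snd p) < heis_index (fst p) then -1 else (1::rat))"
    by (simp add: prod.cartesian_product case_prod_beta)
  also have "\<dots> = (\<Prod>p\<in>{p \<in> A \<times> B. heis_index (snd p) < heis_index (fst p)}. -1)"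
    using finite_heis_gen_set by (subst prod.inter_filter) auto
  also have "{p \<in> A \<times> B. heis_index (snd p) < heis_index (fst p)} =
      {(s, t) \<in> A \<times> B. heis_index t < heis_index s}"
    by auto
  finally show ?thesis by (simp add: wedge_sign_def)
qed

lemmas heis_model_simps = heis_model_def monomial_def Pow_insert wedge_sign_prod insert_Diff_if
  image_Un sum.union_disjoint insert_eq_iff algebra_simps doubleton_eq_iff

lemma heis_model_unit:
  "unit heis_model \<and>\<^sub>m a = a" "a \<and>\<^sub>m unit heis_model = a"
  unfolding heis_elt_eq_iff heis_gen_all_sets by (simp_all add: heis_model_simps)

lemma heis_model_assoc: "(a \<and>\<^sub>m b) \<and>\<^sub>m c = a \<and>\<^sub>m (b \<and>\<^sub>m c)"
  unfolding heis_elt_eq_iff heis_gen_all_sets by (simp add: heis_model_simps)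

lemma heis_model_mult_component:
  assumes "a \<in> component heis_model p" "b \<in> component heis_model q"
  shows "a \<and>\<^sub>m b \<in> component heis_model (p + q)"
proof -
  have "card U = p + q" if "(a \<and>\<^sub>m b) U \<noteq> 0" for U
  proof -
    have "(\<Sum>S\<in>Pow U. wedge_sign S (U - S) * a S * b (U - S)) \<noteq> 0"
      using that by (simp add: heis_model_def)
    then obtain S where "S \<subseteq> U" "a S \<noteq> 0" "b (U - S) \<noteq> 0"
      by (metis (no_types, lifting) PowD mult_eq_0_iff sum.neutral)
    then show ?thesis
      using assms finite_heis_gen_set card_Diff_subset[of S U] card_mono[of U S]
      by (auto simp: heis_model_def)
  qed
  then show ?thesis by (simp add: heis_model_def)
qed

lemma heis_model_leibniz:
  assumes "a \<in> component heis_model p"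
  shows "diff heis_model (a \<and>\<^sub>m b) =
    diff heis_model a \<and>\<^sub>m b + scale heis_model ((-1) ^ p) (a \<and>\<^sub>m diff heis_model b)"
proof -
  have "a {} = 0 \<or> p = 0" "a {GW} = 0 \<or> p = 1"
    using assms by (auto simp: heis_model_def)
  then show ?thesis
    unfolding heis_elt_eq_iff heis_gen_all_sets by (elim disjE) (simp_all add: heis_model_simps)
qed

lemma is_dga_heis_model: "is_dga heis_model"
  unfolding is_dga_def
proof (intro conjI allI ballI)
  show vs: "vector_space (scale heis_model)"
    by unfold_locales (auto simp: heis_model_def algebra_simps)
  interpret vector_space "scale heis_model" by (rule vs)
  show "subspace (component heis_model n)" for n
    unfolding subspace_def by (auto simp: heis_model_def) (metis add.right_neutral)
  show "unit heis_model \<in> component heis_model 0"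
    by (auto simp: heis_model_def monomial_def)
  fix n p q r and a a' b b' c :: "heis_gen set \<Rightarrow> rat"
  show "unit heis_model \<and>\<^sub>m a = a" "a \<and>\<^sub>m unit heis_model = a"
    by (rule heis_model_unit)+
  show "(a \<and>\<^sub>m b) \<and>\<^sub>m c = a \<and>\<^sub>m (b \<and>\<^sub>m c)"
    by (rule heis_model_assoc)
  show "(a + a') \<and>\<^sub>m b = a \<and>\<^sub>m b + a' \<and>\<^sub>m b" "a \<and>\<^sub>m (b + b') = a \<and>\<^sub>m b + a \<and>\<^sub>m b'"
    "scale heis_model s a \<and>\<^sub>m b = scale heis_model s (a \<and>\<^sub>m b)"
    "a \<and>\<^sub>m scale heis_model s b = scale heis_model s (a \<and>\<^sub>m b)" for s
    by (simp_all add: heis_model_def fun_eq_iff algebra_simps sum.distrib sum_distrib_left)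
  show "diff heis_model (diff heis_model a) = 0"
    "diff heis_model (a + b) = diff heis_model a + diff heis_model b"
    "diff heis_model (scale heis_model s a) = scale heis_model s (diff heis_model a)" for s
    by (simp_all add: heis_model_def fun_eq_iff doubleton_eq_iff)
  assume a: "a \<in> component heis_model p"
  show "diff heis_model a \<in> component heis_model (Suc p)"
    using a by (auto simp: heis_model_def split: if_splits)
  show "diff heis_model (a \<and>\<^sub>m b) =
      diff heis_model a \<and>\<^sub>m b + scale heis_model ((-1) ^ p) (a \<and>\<^sub>m diff heis_model b)"
    using a by (rule heis_model_leibniz)
  assume "b \<in> component heis_model q"
  with a show "a \<and>\<^sub>m b \<in> component heis_model (p + q)"
    by (rule heis_model_mult_component)
qed

text \<open>The generators satisfy the defining relations of \<open>\<Lambda>(x, y, w)\<close>.\<close>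

lemma heis_model_generators:
  "diff heis_model model_x = 0"
  "diff heis_model model_y = 0"
  "diff heis_model model_w = model_x \<and>\<^sub>m model_y"
  "model_y \<and>\<^sub>m model_x = - (model_x \<and>\<^sub>m model_y)"
  "model_w \<and>\<^sub>m model_x = - (model_x \<and>\<^sub>m model_w)"
  "model_w \<and>\<^sub>m model_y = - (model_y \<and>\<^sub>m model_w)"
  "model_x \<and>\<^sub>m model_x = 0" "model_y \<and>\<^sub>m model_y = 0" "model_w \<and>\<^sub>m model_w = 0"
  "model_x \<and>\<^sub>m model_y = monomial {GX, GY}"
  "model_x \<and>\<^sub>m model_w = monomial {GX, GW}"
  "model_y \<and>\<^sub>m model_w = monomial {GY, GW}"
  "model_x \<and>\<^sub>m model_y \<and>\<^sub>m model_w = monomial {GX, GY, GW}"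
  unfolding heis_elt_eq_iff heis_gen_all_sets by (simp_all add: heis_model_simps)

section \<open>The identification of the cohomology rings, the pairing and the canonical orientation\<close>

type_synonym heis_class = "(heis_gen set \<Rightarrow> rat) set"
type_synonym manifold_class = "(nat \<Rightarrow> ((nat \<Rightarrow> real) \<Rightarrow> (real^3^3) set) \<Rightarrow> rat) set"

abbreviation heis_cochains ::
    "(nat \<Rightarrow> ((nat \<Rightarrow> real) \<Rightarrow> (real^3^3) set) \<Rightarrow> rat) dga" where
  "heis_cochains \<equiv> singular_cochains heis_manifold"

text \<open>
  \<open>\<Phi>\<close> is the isomorphism \<open>H\<^sup>*(\<Lambda>(x, y, w)) \<cong> H\<^sup>*(M; \<rat>)\<close> induced by a pair of
  quasi-isomorphisms of differential graded algebras from the model and from the singular cochains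
  of \<open>M\<close> to a common target \<open>E\<close>. Sullivan's identification is of this form: the model maps by a
  quasi-isomorphism to the polynomial forms \<open>A\<^sub>P\<^sub>L(M)\<close>, and these are joined to the singular cochains
  by natural quasi-isomorphisms \<open>A\<^sub>P\<^sub>L(M) \<rightarrow> E \<leftarrow> C\<^sup>*(M; \<rat>)\<close>
  (Felix--Halperin--Thomas, Rational Homotopy Theory, Section 10).
\<close>

definition model_identification ::
    "'e::ab_group_add dga \<Rightarrow> ((heis_gen set \<Rightarrow> rat) \<Rightarrow> 'e) \<Rightarrow>
     ((nat \<Rightarrow> ((nat \<Rightarrow> real) \<Rightarrow> (real^3^3) set) \<Rightarrow> rat) \<Rightarrow> 'e) \<Rightarrow>
     (nat \<Rightarrow> heis_class \<Rightarrow> manifold_class) \<Rightarrow> bool" where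
  "model_identification E k j \<Phi> \<longleftrightarrow>
     is_dga E \<and> quasi_iso heis_model E k \<and> quasi_iso heis_cochains E j \<and>
     (\<forall>n. \<forall>u\<in>cohomology heis_model n.
        \<Phi> n u \<in> cohomology heis_cochains n \<and>
        cohomology_map E j n (\<Phi> n u) = cohomology_map E k n u)"

text \<open>
  \<open>c\<close> is a value of the pairing of \<open>x\<^sub>0\<close> and \<open>y\<^sub>0\<close> for some choice of cocycle representatives
  \<open>a\<close>, \<open>b\<close> in the model and of \<open>w\<close> with \<open>d w = a \<and> b\<close>.
\<close>

definition pairing_value ::
    "(nat \<Rightarrow> heis_class \<Rightarrow> manifold_class) \<Rightarrow>
     manifold_class \<Rightarrow> manifold_class \<Rightarrow> manifold_class \<Rightarrow> bool" where
  "pairing_value \<Phi> x\<^sub>0 y\<^sub>0 c \<longleftrightarrow>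
     (\<exists>a\<in>cocycles heis_model 1. \<exists>b\<in>cocycles heis_model 1. \<exists>w\<in>component heis_model 1.
        \<Phi> 1 (cohomology_class heis_model 1 a) = x\<^sub>0 \<and>
        \<Phi> 1 (cohomology_class heis_model 1 b) = y\<^sub>0 \<and>
        diff heis_model w = a \<and>\<^sub>m b \<and>
        c = \<Phi> 3 (cohomology_class heis_model 3 (a \<and>\<^sub>m b \<and>\<^sub>m w)))"

definition pairing ::
    "(nat \<Rightarrow> heis_class \<Rightarrow> manifold_class) \<Rightarrow>
     manifold_class \<Rightarrow> manifold_class \<Rightarrow> manifold_class" where
  "pairing \<Phi> x\<^sub>0 y\<^sub>0 = (THE c. pairing_value \<Phi> x\<^sub>0 y\<^sub>0 c)"

definition canonical_orientation ::
    "(nat \<Rightarrow> heis_class \<Rightarrow> manifold_class) \<Rightarrow> (real^3^3) set chain set" where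
  "canonical_orientation \<Phi> =
     (THE \<mu>. orientation3 heis_manifold \<mu> \<and>
        (\<exists>r>0. \<Phi> 3 (cohomology_class heis_model 3 (model_x \<and>\<^sub>m model_y \<and>\<^sub>m model_w)) =
                class_scale heis_cochains 3 r (dual_class3 heis_manifold \<mu>)))"

end

theory Submission
  imports Defs
begin

text \<open>
  The isomorphism \<open>\<Phi>\<close> is linear and bijective in every degree, so everything about the pairing can be
  computed in the model. There the only coboundaries in degrees one and three are zero, so a class in
  these degrees is the same as a cocycle: the \<open>1\<close>-cocycles are the combinations \<open>p x + q y\<close> and the
  \<open>3\<close>-cocycles are the multiples of \<open>x \<and> y \<and> w\<close>. Given \<open>a x + b y\<close> and \<open>c x + d y\<close>, put
  \<open>\<Delta> = a d - b c\<close>. Their product is \<open>\<Delta> (x \<and> y)\<close>, so a primitive of it is \<open>\<Delta> w\<close> up to a \<open>1\<close>-cocycle,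
  which is killed by multiplication with \<open>x \<and> y\<close>; hence the triple product is \<open>\<Delta>\<^sup>2 (x \<and> y \<and> w)\<close> for
  every choice (\<open>wedge_xy_combination_primitive\<close>, \<open>pairing_value_iff\<close>).

  For the orientations, the geometry of the manifold plays no further role: it is enough that the
  class \<open>\<omega>\<close> of \<open>x \<and> y \<and> w\<close> spans the line \<open>H\<^sup>3(M; \<rat>)\<close>. A rational cocycle that vanishes on all integral
  cycles is a coboundary (\<open>coboundary_if_vanishes_on_cycles\<close>, the injective half of the universal
  coefficient theorem), so \<open>\<omega>\<close> evaluates to a nonzero number \<open>t\<close> on a generator \<open>\<mu>\<close> of \<open>H\<^sub>3(M; \<int>)\<close>,
  and the dual class of \<open>\<mu>\<close> is \<open>\<omega> / t\<close>. Thus a positive multiple of \<open>\<omega>\<close> is a positive multiple of the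
  dual class of \<open>\<mu>\<close> exactly if \<open>t > 0\<close>, and since two generators differ by a sign, this holds for
  exactly one of them. For a basis, \<open>\<Delta> \<noteq> 0\<close> and the pairing is \<open>\<Delta>\<^sup>2 \<omega>\<close> with \<open>\<Delta>\<^sup>2 > 0\<close>, so every basis
  selects this same generator.
\<close>

section \<open>Cohomology classes of a cochain complex\<close>

text \<open>
  A rational cochain complex, the additive part of a differential graded algebra. The product is
  left unconstrained, so that the singular cochains are covered without the laws of the cup product.
\<close>

locale cochain_complex = vector_space "scale A" for A :: "'a::ab_group_add dga" +
  assumes subspace_component: "subspace (component A n)"
    and diff_component: "a \<in> component A n \<Longrightarrow> diff A a \<in> component A (Suc n)"
    and diff_diff: "a \<in> component A n \<Longrightarrow> diff A (diff A a) = 0"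
    and diff_add: "\<lbrakk>a \<in> component A n; b \<in> component A n\<rbrakk> \<Longrightarrow> diff A (a + b) = diff A a + diff A b"
    and diff_scale: "a \<in> component A n \<Longrightarrow> diff A (scale A r a) = scale A r (diff A a)"
begin

lemma diff_zero: "diff A 0 = 0"
  using diff_scale[OF subspace_0[OF subspace_component], where r = 0] by simp

lemma subspace_cocycles: "subspace (cocycles A n)"
  using subspace_component[of n]
  by (auto simp: subspace_def cocycles_def diff_zero diff_add diff_scale)

lemma subspace_coboundaries: "subspace (coboundaries A n)"
proof (cases n)
  case 0
  then show ?thesis by (simp add: coboundaries_def)
next
  case (Suc m)
  have "0 \<in> diff A ` component A m"
    using subspace_0[OF subspace_component[of m]] diff_zero by (metis image_eqI)
  moreover have "diff A a + diff A b \<in> diff A ` component A m"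
    if "a \<in> component A m" "b \<in> component A m" for a b
    using that subspace_add[OF subspace_component[of m]] by (metis diff_add image_eqI)
  moreover have "scale A r (diff A a) \<in> diff A ` component A m"
    if "a \<in> component A m" for a r
    using that subspace_scale[OF subspace_component[of m]] by (metis diff_scale image_eqI)
  ultimately show ?thesis
    by (auto simp: Suc coboundaries_def subspace_def)
qed

lemma coboundaries_component: "b \<in> coboundaries A n \<Longrightarrow> b \<in> component A n"
  using subspace_0[OF subspace_component] diff_component
  by (cases n) (auto simp: coboundaries_def)

lemma cohomology_class_eq_iff:
  "cohomology_class A n z = cohomology_class A n z' \<longleftrightarrow> z - z' \<in> coboundaries A n"
proof
  assume "cohomology_class A n z = cohomology_class A n z'"
  then have "z \<in> cohomology_class A n z'"
    using subspace_0[OF subspace_coboundaries] unfolding cohomology_class_def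
    by (metis add.right_neutral image_eqI)
  then show "z - z' \<in> coboundaries A n"
    by (auto simp: cohomology_class_def)
next
  have sub: "cohomology_class A n u \<subseteq> cohomology_class A n v"
    if d: "u - v \<in> coboundaries A n" for u v
  proof
    fix t assume "t \<in> cohomology_class A n u"
    then obtain b where b: "b \<in> coboundaries A n" "t = u + b"
      by (auto simp: cohomology_class_def)
    then have "t = v + ((u - v) + b)" by simp
    then show "t \<in> cohomology_class A n v"
      unfolding cohomology_class_def
      using subspace_add[OF subspace_coboundaries d b(1)] by blast
  qed
  assume d: "z - z' \<in> coboundaries A n"
  then have "z' - z \<in> coboundaries A n"
    using subspace_neg[OF subspace_coboundaries d] by simp
  with d show "cohomology_class A n z = cohomology_class A n z'"
    using sub by blast
qed

lemma mem_cohomology_class_iff: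
  "a \<in> cohomology_class A n z \<longleftrightarrow> cohomology_class A n a = cohomology_class A n z"
  unfolding cohomology_class_eq_iff by (force simp: cohomology_class_def)

lemma self_mem_cohomology_class: "z \<in> cohomology_class A n z"
  by (simp add: mem_cohomology_class_iff)

lemma class_add_cohomology_class:
  "class_add A n (cohomology_class A n a) (cohomology_class A n b) = cohomology_class A n (a + b)"
proof -
  have "cohomology_class A n (a' + b') = cohomology_class A n (a + b)"
    if "a' \<in> cohomology_class A n a" "b' \<in> cohomology_class A n b" for a' b'
  proof -
    have "(a' - a) + (b' - b) \<in> coboundaries A n"
      using that subspace_add[OF subspace_coboundaries]
      by (simp add: mem_cohomology_class_iff cohomology_class_eq_iff)
    then show ?thesis by (simp add: cohomology_class_eq_iff algebra_simps)
  qed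
  then show ?thesis
    using self_mem_cohomology_class unfolding class_add_def by blast
qed

lemma class_scale_cohomology_class:
  "class_scale A n r (cohomology_class A n a) = cohomology_class A n (scale A r a)"
proof -
  have "cohomology_class A n (scale A r a') = cohomology_class A n (scale A r a)"
    if "a' \<in> cohomology_class A n a" for a'
    using that subspace_scale[OF subspace_coboundaries, of "a' - a" n r]
    by (simp add: mem_cohomology_class_iff cohomology_class_eq_iff scale_right_diff_distrib)
  then show ?thesis
    using self_mem_cohomology_class unfolding class_scale_def by blast
qed

lemma class_add_in_cohomology:
  assumes "u \<in> cohomology A n" "v \<in> cohomology A n"
  shows "class_add A n u v \<in> cohomology A n"
  using assms subspace_add[OF subspace_cocycles]
  by (auto simp: cohomology_def class_add_cohomology_class)

lemma class_scale_in_cohomology: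
  assumes "u \<in> cohomology A n"
  shows "class_scale A n r u \<in> cohomology A n"
  using assms subspace_scale[OF subspace_cocycles]
  by (auto simp: cohomology_def class_scale_cohomology_class)

lemma class_scale_class_scale:
  assumes "u \<in> cohomology A n"
  shows "class_scale A n r (class_scale A n s u) = class_scale A n (r * s) u"
  using assms by (auto simp: cohomology_def class_scale_cohomology_class)

end

lemma is_dga_imp_cochain_complex: "is_dga A \<Longrightarrow> cochain_complex A"
  unfolding is_dga_def
  by (auto simp: cochain_complex_def cochain_complex_axioms_def)

section \<open>Maps induced on cohomology\<close>

text \<open>
  A homomorphism of differential graded algebras, regarded as a map of the underlying complexes;
  only its additive properties are used.
\<close>

locale cochain_map = src: cochain_complex A + tgt: cochain_complex B
  for A :: "'a::ab_group_add dga" and B :: "'b::ab_group_add dga" +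
  fixes f :: "'a \<Rightarrow> 'b"
  assumes hom: "dga_hom A B f"
begin

lemma map_component: "a \<in> component A n \<Longrightarrow> f a \<in> component B n"
  and map_diff: "a \<in> component A n \<Longrightarrow> f (diff A a) = diff B (f a)"
  and map_add: "\<lbrakk>a \<in> component A n; b \<in> component A n\<rbrakk> \<Longrightarrow> f (a + b) = f a + f b"
  and map_scale: "a \<in> component A n \<Longrightarrow> f (scale A r a) = scale B r (f a)"
  using hom unfolding dga_hom_def by blast+

lemma map_zero: "f 0 = 0"
  using map_scale[OF src.subspace_0[OF src.subspace_component], where r = 0] by simp

lemma map_coboundaries: "b \<in> coboundaries A n \<Longrightarrow> f b \<in> coboundaries B n"
  using map_component map_zero by (auto simp: coboundaries_def map_diff)

lemma cohomology_map_class: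
  assumes "z \<in> cocycles A n"
  shows "cohomology_map B f n (cohomology_class A n z) = cohomology_class B n (f z)"
proof -
  have "cohomology_class B n (f a) = cohomology_class B n (f z)"
    if a: "a \<in> cohomology_class A n z" for a
  proof -
    obtain b where b: "b \<in> coboundaries A n" "a = z + b"
      using a by (auto simp: cohomology_class_def)
    then have "f a = f z + f b"
      using assms map_add src.coboundaries_component by (auto simp: cocycles_def)
    with b(1) show ?thesis
      by (simp add: tgt.cohomology_class_eq_iff map_coboundaries)
  qed
  then show ?thesis
    using src.self_mem_cohomology_class unfolding cohomology_map_def by blast
qed

lemma cohomology_map_add:
  assumes "u \<in> cohomology A n" "v \<in> cohomology A n"
  shows "cohomology_map B f n (class_add A n u v) =
    class_add B n (cohomology_map B f n u) (cohomology_map B f n v)"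
proof -
  obtain a b where ab: "a \<in> cocycles A n" "u = cohomology_class A n a"
    "b \<in> cocycles A n" "v = cohomology_class A n b"
    using assms by (auto simp: cohomology_def)
  moreover from ab have "a + b \<in> cocycles A n"
    using src.subspace_add[OF src.subspace_cocycles] by blast
  moreover from ab have "f (a + b) = f a + f b"
    using map_add by (auto simp: cocycles_def)
  ultimately show ?thesis
    by (simp add: src.class_add_cohomology_class tgt.class_add_cohomology_class cohomology_map_class)
qed

lemma cohomology_map_scale:
  assumes "u \<in> cohomology A n"
  shows "cohomology_map B f n (class_scale A n r u) = class_scale B n r (cohomology_map B f n u)"
proof -
  obtain a where a: "a \<in> cocycles A n" "u = cohomology_class A n a"
    using assms by (auto simp: cohomology_def)
  moreover from a have "scale A r a \<in> cocycles A n"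
    using src.subspace_scale[OF src.subspace_cocycles] by blast
  moreover from a have "f (scale A r a) = scale B r (f a)"
    using map_scale by (auto simp: cocycles_def)
  ultimately show ?thesis
    by (simp add: src.class_scale_cohomology_class tgt.class_scale_cohomology_class cohomology_map_class)
qed

end

section \<open>Evaluation of cochains on chains\<close>

lemma chain_eval_superset:
  assumes "finite K" "Poly_Mapping.keys c \<subseteq> K"
  shows "chain_eval f c = (\<Sum>\<sigma>\<in>K. of_int (Poly_Mapping.lookup c \<sigma>) * f \<sigma>)"
  unfolding chain_eval_def
  by (rule sum.mono_neutral_left) (use assms in \<open>auto simp: in_keys_iff\<close>)

lemma chain_eval_add: "chain_eval f (a + b) = chain_eval f a + chain_eval f b"
proof -
  let ?K = "Poly_Mapping.keys a \<union> Poly_Mapping.keys b"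
  have "chain_eval f c = (\<Sum>\<sigma>\<in>?K. of_int (Poly_Mapping.lookup c \<sigma>) * f \<sigma>)"
    if "c \<in> {a, b, a + b}" for c
    by (rule chain_eval_superset) (use that Poly_Mapping.keys_add[of a b] in auto)
  then show ?thesis
    by (simp add: lookup_add algebra_simps sum.distrib)
qed

lemma chain_eval_zero [simp]: "chain_eval f 0 = 0"
  by (simp add: chain_eval_def)

lemma chain_eval_diff: "chain_eval f (a - b) = chain_eval f a - chain_eval f b"
  using chain_eval_add[of f "a - b" b] by simp

lemma chain_eval_frag_of [simp]: "chain_eval f (frag_of \<sigma>) = f \<sigma>"
  by (simp add: chain_eval_def)

lemma chain_eval_cmul: "chain_eval f (frag_cmul m c) = of_int m * chain_eval f c"
proof -
  have "chain_eval f (frag_cmul m c) =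
      (\<Sum>\<sigma>\<in>Poly_Mapping.keys c. of_int (Poly_Mapping.lookup (frag_cmul m c) \<sigma>) * f \<sigma>)"
    by (rule chain_eval_superset) auto
  then show ?thesis by (simp add: chain_eval_def sum_distrib_left mult.assoc)
qed

lemma chain_eval_sum: "chain_eval f (\<Sum>i\<in>I. c i) = (\<Sum>i\<in>I. chain_eval f (c i))"
  by (induction I rule: infinite_finite_induct) (simp_all add: chain_eval_add)

lemma chain_eval_cong:
  assumes "\<And>\<sigma>. \<sigma> \<in> Poly_Mapping.keys c \<Longrightarrow> f \<sigma> = g \<sigma>"
  shows "chain_eval f c = chain_eval g c"
  using assms by (simp add: chain_eval_def)

lemma sum_fun_apply: "(\<Sum>i\<in>I. f i) x = (\<Sum>i\<in>I. f i x)"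
  by (induction I rule: infinite_finite_induct) simp_all

lemma common_denominator:
  fixes q :: "'b \<Rightarrow> rat"
  assumes "finite T"
  shows "\<exists>N::int. N > 0 \<and> (\<exists>m. \<forall>b\<in>T. of_int N * q b = of_int (m b))"
  using assms
proof (induction T)
  case empty
  show ?case by (rule exI[of _ 1]) simp
next
  case (insert c T)
  then obtain N :: int and m where N: "N > 0" "\<forall>b\<in>T. of_int N * q b = of_int (m b)"
    by blast
  obtain a d :: int where d: "d > 0" "q c = Fract a d"
    by (metis quotient_of_denom_pos quotient_of_unique prod.collapse)
  then have c: "of_int d * q c = of_int a"
    by (simp add: Fract_of_int_quotient)
  show ?case
  proof (intro exI conjI ballI)
    show "N * d > 0" using N(1) d(1) by simp
    fix b assume "b \<in> insert c T"
    then show "of_int (N * d) * q b = of_int (if b = c then N * a else d * m b)"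
      using N(2) c insert.hyps by (auto simp: mult.assoc mult.left_commute)
  qed
qed

text \<open>
  A homomorphism from chains to the rationals that vanishes on the kernel of an additive map \<open>bd\<close> factors
  through \<open>bd\<close>, and the factor, given on the image of \<open>bd\<close>, extends to all chains since the
  rationals are divisible. The extension is obtained by linear algebra: chains embed into the
  rational vector space of all functions on simplices, where a functional can be prescribed on a
  basis of the span of the boundaries. That it then takes the right value on every boundary follows by
  clearing denominators.
\<close>

lemma extend_along_boundary:
  fixes f :: "((nat \<Rightarrow> real) \<Rightarrow> 'x) \<Rightarrow> rat" and bd :: "'x chain \<Rightarrow> 'x chain"
  assumes diff: "\<And>a b. bd (a - b) = bd a - bd b"
    and vanish: "\<And>z. \<lbrakk>Poly_Mapping.keys z \<subseteq> S; bd z = 0\<rbrakk> \<Longrightarrow> chain_eval f z = 0"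
  shows "\<exists>g. \<forall>\<sigma>\<in>S. chain_eval g (bd (frag_of \<sigma>)) = f \<sigma>"
proof -
  define sc :: "rat \<Rightarrow> (((nat \<Rightarrow> real) \<Rightarrow> 'x) \<Rightarrow> rat) \<Rightarrow> ((nat \<Rightarrow> real) \<Rightarrow> 'x) \<Rightarrow> rat"
    where "sc = (\<lambda>r v \<tau>. r * v \<tau>)"
  interpret V: vector_space sc
    by unfold_locales (auto simp: sc_def algebra_simps)
  interpret Q: vector_space "(*) :: rat \<Rightarrow> rat \<Rightarrow> rat"
    by unfold_locales (auto simp: algebra_simps)
  interpret VQ: vector_space_pair sc "(*) :: rat \<Rightarrow> rat \<Rightarrow> rat" ..
  have zero: "bd 0 = 0" using diff[of 0 0] by simp
  have uminus: "bd (- a) = - bd a" for a using diff[of 0 a] zero by simp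
  have add: "bd (a + b) = bd a + bd b" for a b using diff[of a "- b"] uminus by simp
  have cmul: "bd (frag_cmul m c) = frag_cmul m (bd c)" for m c
  proof (induction m rule: int_induct[where k = 0])
    case base then show ?case by (simp add: zero)
  next
    case (step1 i) then show ?case by (simp add: frag_cmul_distrib add)
  next
    case (step2 i) then show ?case by (simp add: frag_cmul_diff_distrib diff)
  qed
  have sum: "bd (\<Sum>i\<in>I. c i) = (\<Sum>i\<in>I. bd (c i))" for I :: "(((nat \<Rightarrow> real) \<Rightarrow> 'x) \<Rightarrow> rat) set" and c
    by (induction I rule: infinite_finite_induct) (simp_all add: zero add)
  define emb :: "'x chain \<Rightarrow> ((nat \<Rightarrow> real) \<Rightarrow> 'x) \<Rightarrow> rat"
    where "emb = (\<lambda>c \<tau>. of_int (Poly_Mapping.lookup c \<tau>))"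
  define D where "D = (\<lambda>\<sigma>. emb (bd (frag_of \<sigma>)))"
  obtain B where B: "B \<subseteq> D ` S" "V.independent B" "D ` S \<subseteq> V.span B"
    using V.maximal_independent_subset .
  obtain s where s: "\<And>b. b \<in> B \<Longrightarrow> s b \<in> S \<and> D (s b) = b"
    using B(1) by (metis (no_types, lifting) image_iff subsetD)
  obtain L where L: "Vector_Spaces.linear sc (*) L" "\<And>b. b \<in> B \<Longrightarrow> L b = f (s b)"
    using VQ.linear_independent_extend[OF B(2), of "\<lambda>b. f (s b)"] by blast
  interpret L: Vector_Spaces.linear sc "(*) :: rat \<Rightarrow> rat \<Rightarrow> rat" L by (rule L(1))
  have LD: "L (D \<sigma>) = f \<sigma>" if \<sigma>: "\<sigma> \<in> S" for \<sigma>
  proof -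
    obtain T q where T: "finite T" "T \<subseteq> B" "D \<sigma> = (\<Sum>b\<in>T. sc (q b) b)"
      using B(3) \<sigma> unfolding V.span_explicit by blast
    obtain N :: int and m where N: "N > 0" "\<And>b. b \<in> T \<Longrightarrow> of_int N * q b = of_int (m b)"
      using common_denominator[OF T(1), of q] by blast
    \<comment> \<open>The linear relation between boundaries, multiplied by a common denominator, gives an integral cycle.\<close>
    define z where "z = frag_cmul N (frag_of \<sigma>) - (\<Sum>b\<in>T. frag_cmul (m b) (frag_of (s b)))"
    have "Poly_Mapping.keys (\<Sum>b\<in>T. frag_cmul (m b) (frag_of (s b))) \<subseteq> S"
      using T(2) s by (intro order_trans[OF keys_sum]) (auto simp: keys_frag_of)
    then have keys: "Poly_Mapping.keys z \<subseteq> S"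
      unfolding z_def using \<sigma> by (intro order_trans[OF keys_diff]) (auto simp: keys_frag_of)
    have emb_z: "emb (bd z) \<tau> = 0" for \<tau>
    proof -
      have "emb (bd z) \<tau> = of_int N * D \<sigma> \<tau> - (\<Sum>b\<in>T. of_int (m b) * D (s b) \<tau>)"
        by (simp add: z_def diff sum cmul emb_def D_def lookup_minus lookup_sum)
      also have "(\<Sum>b\<in>T. of_int (m b) * D (s b) \<tau>) = (\<Sum>b\<in>T. of_int N * (q b * b \<tau>))"
        using T(2) s by (intro sum.cong refl) (auto simp: mult.assoc simp flip: N(2))
      also have "\<dots> = of_int N * D \<sigma> \<tau>"
        by (simp add: T(3) sc_def sum_distrib_left sum_fun_apply)
      finally show ?thesis by simp
    qed
    have "bd z = 0"
      using emb_z by (intro poly_mapping_eqI) (simp add: emb_def)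
    with keys have "chain_eval f z = 0" by (rule vanish)
    then have "of_int N * f \<sigma> = (\<Sum>b\<in>T. of_int (m b) * f (s b))"
      by (simp add: z_def chain_eval_diff chain_eval_cmul chain_eval_sum)
    also have "\<dots> = of_int N * (\<Sum>b\<in>T. q b * f (s b))"
      using T(2) s by (auto simp: sum_distrib_left mult.assoc simp flip: N(2) intro!: sum.cong)
    also have "(\<Sum>b\<in>T. q b * f (s b)) = L (D \<sigma>)"
      using T(2) L(2) by (auto simp: T(3) L.sum L.scale intro!: sum.cong)
    finally show ?thesis using N(1) by simp
  qed
  define g where "g = (\<lambda>\<tau>. L (\<lambda>\<tau>'. if \<tau>' = \<tau> then 1 else 0))"
  have "L (emb c) = chain_eval g c" for c
  proof -
    have "emb c = (\<Sum>\<tau>\<in>Poly_Mapping.keys c. sc (emb c \<tau>) (\<lambda>\<tau>'. if \<tau>' = \<tau> then 1 else 0))"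
    proof
      fix \<tau>'
      have "(\<Sum>\<tau>\<in>Poly_Mapping.keys c. sc (emb c \<tau>) (\<lambda>\<tau>'. if \<tau>' = \<tau> then 1 else 0)) \<tau>' =
          (\<Sum>\<tau>\<in>Poly_Mapping.keys c. if \<tau>' = \<tau> then emb c \<tau> else 0)"
        by (simp add: sc_def sum_fun_apply if_distrib cong: if_cong)
      then show "emb c \<tau>' =
          (\<Sum>\<tau>\<in>Poly_Mapping.keys c. sc (emb c \<tau>) (\<lambda>\<tau>'. if \<tau>' = \<tau> then 1 else 0)) \<tau>'"
        by (simp add: emb_def in_keys_iff)
    qed
    then have "L (emb c) = (\<Sum>\<tau>\<in>Poly_Mapping.keys c. emb c \<tau> * g \<tau>)"
      unfolding g_def by (metis (no_types, lifting) L.sum L.scale sum.cong)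
    then show ?thesis by (simp add: chain_eval_def emb_def)
  qed
  then show ?thesis using LD by (auto simp: D_def)
qed

section \<open>Singular cochains and the Kronecker pairing\<close>

lemma singular_cochains_simps:
  "component (singular_cochains X) n = {f. \<forall>m \<sigma>. f m \<sigma> \<noteq> 0 \<longrightarrow> m = n \<and> singular_simplex n X \<sigma>}"
  "scale (singular_cochains X) r f m \<sigma> = r * f m \<sigma>"
  "diff (singular_cochains X) f m \<sigma> =
     (if m > 0 \<and> singular_simplex m X \<sigma> then chain_eval (f (m - 1)) (chain_boundary m (frag_of \<sigma>)) else 0)"
  by (simp_all add: singular_cochains_def)

lemma chain_eval_diff_cochain:
  assumes "singular_chain (Suc n) X c"
  shows "chain_eval (diff (singular_cochains X) f (Suc n)) c = chain_eval (f n) (chain_boundary (Suc n) c)"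
  using assms unfolding singular_chain_def
  by (induction c rule: frag_induction)
    (simp_all add: singular_cochains_simps chain_eval_diff chain_boundary_diff)

lemma chain_eval_add_cochain: "chain_eval (\<lambda>\<sigma>. f \<sigma> + g \<sigma>) c = chain_eval f c + chain_eval g c"
  by (simp add: chain_eval_def algebra_simps sum.distrib)

lemma chain_eval_scale_cochain: "chain_eval (\<lambda>\<sigma>. r * f \<sigma>) c = r * chain_eval f c"
  by (simp add: chain_eval_def algebra_simps sum_distrib_left)

lemma chain_eval_zero_cochain: "chain_eval (\<lambda>\<sigma>. 0) c = 0"
  by (simp add: chain_eval_def)

lemma cochain_complex_singular_cochains: "cochain_complex (singular_cochains X)"
proof -
  let ?C = "singular_cochains X"
  interpret vector_space "scale ?C"
    by unfold_locales (auto simp: singular_cochains_def fun_eq_iff algebra_simps)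
  show ?thesis
  proof
    fix n r and f g :: "nat \<Rightarrow> ((nat \<Rightarrow> real) \<Rightarrow> 'a) \<Rightarrow> rat"
    show "subspace (component ?C n)"
      unfolding subspace_def by (auto simp: singular_cochains_simps) (metis add.right_neutral)+
    assume f: "f \<in> component ?C n"
    then have f0: "f m = (\<lambda>\<sigma>. 0)" if "m \<noteq> n" for m
      using that by (auto simp: singular_cochains_simps)
    show "diff ?C f \<in> component ?C (Suc n)"
      unfolding singular_cochains_simps(1)[of X "Suc n"] mem_Collect_eq
    proof (intro allI impI)
      fix m \<sigma> assume nz: "diff ?C f m \<sigma> \<noteq> 0"
      then have m: "m > 0" "singular_simplex m X \<sigma>"
          "chain_eval (f (m - 1)) (chain_boundary m (frag_of \<sigma>)) \<noteq> 0"
        by (auto simp: singular_cochains_simps(3) split: if_splits)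
      then have "f (m - 1) \<noteq> (\<lambda>\<sigma>. 0)"
        by (metis chain_eval_zero_cochain)
      with f0 have "m - 1 = n" by blast
      with m show "m = Suc n \<and> singular_simplex (Suc n) X \<sigma>" by auto
    qed
    show "diff ?C (diff ?C f) = 0"
    proof (intro ext)
      fix m \<sigma>
      show "diff ?C (diff ?C f) m \<sigma> = 0 m \<sigma>"
      proof (cases "m > 1 \<and> singular_simplex m X \<sigma>")
        case True
        define k where "k = m - 2"
        with True have k: "m = Suc (Suc k)" by linarith
        from True have c: "singular_chain m X (frag_of \<sigma>)"
          by (simp add: singular_chain_of)
        from True have "diff ?C (diff ?C f) m \<sigma> =
            chain_eval (diff ?C f (Suc k)) (chain_boundary m (frag_of \<sigma>))"
          by (simp add: k singular_cochains_simps(3)[of X "diff ?C f"])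
        also have "\<dots> = chain_eval (f k) (chain_boundary (Suc k) (chain_boundary m (frag_of \<sigma>)))"
          using singular_chain_boundary_alt c unfolding k by (intro chain_eval_diff_cochain) blast
        also have "chain_boundary (Suc k) (chain_boundary m (frag_of \<sigma>)) = 0"
          using chain_boundary_boundary_alt c unfolding k by blast
        finally show ?thesis by simp
      next
        case False
        have "diff ?C f 0 = (\<lambda>\<sigma>. 0)"
          by (simp add: fun_eq_iff singular_cochains_simps)
        with False show ?thesis
          by (cases "m = 1") (auto simp: singular_cochains_simps chain_eval_zero_cochain)
      qed
    qed
    show "diff ?C (scale ?C r f) = scale ?C r (diff ?C f)"
      by (simp add: fun_eq_iff singular_cochains_def chain_eval_scale_cochain)
    show "diff ?C (f + g) = diff ?C f + diff ?C g"
      by (simp add: fun_eq_iff singular_cochains_simps plus_fun_def chain_eval_add_cochain)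
  qed
qed

lemma chain_eval_coboundary_cycle:
  assumes "b \<in> coboundaries (singular_cochains X) n" "singular_relcycle n X {} z"
  shows "chain_eval (b n) z = 0"
proof (cases n)
  case 0
  with assms show ?thesis
    by (simp add: coboundaries_def zero_fun_def chain_eval_zero_cochain)
next
  case (Suc m)
  with assms obtain g where "b = diff (singular_cochains X) g"
    by (auto simp: coboundaries_def)
  with assms Suc show ?thesis
    by (simp add: chain_eval_diff_cochain singular_cycle)
qed

lemma chain_eval_cocycle_boundary:
  assumes "f \<in> cocycles (singular_cochains X) n" "singular_relboundary n X {} c"
  shows "chain_eval (f n) c = 0"
proof -
  obtain d where d: "singular_chain (Suc n) X d" "c = chain_boundary (Suc n) d"
    using assms(2) by (auto simp: singular_boundary)
  have "chain_eval (f n) c = chain_eval (diff (singular_cochains X) f (Suc n)) d"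
    using d by (simp add: chain_eval_diff_cochain)
  then show ?thesis
    using assms(1) by (simp add: cocycles_def zero_fun_def chain_eval_zero_cochain)
qed

lemma kronecker_eq_chain_eval:
  assumes f: "f \<in> cocycles (singular_cochains X) n" and z: "singular_relcycle n X {} z"
  shows "kronecker n (cohomology_class (singular_cochains X) n f) (homologous_rel_set n X {} z) =
    chain_eval (f n) z"
proof -
  let ?C = "singular_cochains X"
  interpret cochain_complex ?C by (rule cochain_complex_singular_cochains)
  have eq: "chain_eval (f' n) z' = chain_eval (f n) z"
    if f': "f' \<in> cohomology_class ?C n f" and z': "homologous_rel n X {} z z'" for f' z'
  proof -
    obtain b where b: "b \<in> coboundaries ?C n" "f' = f + b"
      using f' by (auto simp: cohomology_class_def)
    have bd: "singular_relboundary n X {} (z - z')"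
      using z' by (simp add: homologous_rel_def)
    then have "singular_relcycle n X {} z'"
      using singular_relcycle_diff[OF z] singular_relboundary_imp_relcycle by fastforce
    with b have "chain_eval (f' n) z' = chain_eval (f n) z'"
      using chain_eval_coboundary_cycle by (simp add: plus_fun_def chain_eval_add_cochain)
    with chain_eval_cocycle_boundary[OF f bd] show ?thesis
      by (simp add: chain_eval_diff)
  qed
  show ?thesis
    unfolding kronecker_def
  proof (rule the_equality)
    show "\<forall>f'\<in>cohomology_class ?C n f. \<forall>z'\<in>homologous_rel_set n X {} z.
        chain_eval (f' n) z' = chain_eval (f n) z"
      using eq by blast
  next
    fix r
    assume "\<forall>f'\<in>cohomology_class ?C n f. \<forall>z'\<in>homologous_rel_set n X {} z. chain_eval (f' n) z' = r"
    from bspec[OF bspec[OF this self_mem_cohomology_class], of z] have "chain_eval (f n) z = r"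
      by simp
    then show "r = chain_eval (f n) z" ..
  qed
qed

text \<open>
  Injectivity of the map from \<open>H\<^sup>n(X; \<rat>)\<close> to \<open>Hom(H\<^sub>n(X; \<int>), \<rat>)\<close> in positive degrees \<open>n\<close>.
\<close>

lemma coboundary_if_vanishes_on_cycles:
  assumes f: "f \<in> component (singular_cochains X) (Suc n)"
    and vanish: "\<And>z. singular_relcycle (Suc n) X {} z \<Longrightarrow> chain_eval (f (Suc n)) z = 0"
  shows "f \<in> coboundaries (singular_cochains X) (Suc n)"
proof -
  let ?C = "singular_cochains X"
  have "\<exists>g. \<forall>\<sigma>\<in>singular_simplex_set (Suc n) X.
      chain_eval g (chain_boundary (Suc n) (frag_of \<sigma>)) = f (Suc n) \<sigma>"
    by (rule extend_along_boundary)
      (use vanish in \<open>auto simp: chain_boundary_diff singular_cycle singular_chain_def\<close>)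
  then obtain g where g: "\<And>\<sigma>. singular_simplex (Suc n) X \<sigma> \<Longrightarrow>
      chain_eval g (chain_boundary (Suc n) (frag_of \<sigma>)) = f (Suc n) \<sigma>"
    by blast
  \<comment> \<open>Cochains have to vanish outside the singular simplices of the space.\<close>
  define h where "h = (\<lambda>m \<tau>. if m = n \<and> singular_simplex n X \<tau> then g \<tau> else 0)"
  have "diff ?C h m \<sigma> = f m \<sigma>" for m \<sigma>
  proof (cases "m = Suc n \<and> singular_simplex m X \<sigma>")
    case True
    then have "singular_chain n X (chain_boundary (Suc n) (frag_of \<sigma>))"
      by (intro singular_chain_boundary_alt) (auto simp: singular_chain_of)
    then have "chain_eval (h n) (chain_boundary (Suc n) (frag_of \<sigma>)) =
        chain_eval g (chain_boundary (Suc n) (frag_of \<sigma>))"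
      by (intro chain_eval_cong) (auto simp: h_def singular_chain_def)
    with True g show ?thesis by (auto simp: singular_cochains_simps)
  next
    case False
    then have "f m \<sigma> = 0" using f by (auto simp: singular_cochains_simps)
    moreover have "h (m - 1) = (\<lambda>\<tau>. 0)" if "m \<noteq> Suc n" "m > 0"
      using that by (cases m) (auto simp: h_def)
    ultimately show ?thesis
      using False by (cases "m = Suc n") (auto simp: singular_cochains_simps chain_eval_zero_cochain)
  qed
  moreover have "h \<in> component ?C n"
    by (auto simp: h_def singular_cochains_simps)
  ultimately show ?thesis
    unfolding coboundaries_def by (metis (no_types, lifting) diff_Suc_1 ext image_eqI nat.distinct(1))
qed

section \<open>Orientations\<close>

lemma int_pow_homology_group:
  assumes "singular_relcycle n X {} z"
  shows "homologous_rel_set n X {} z [^]\<^bsub>homology_group (int n) X\<^esub> (m::int) =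
    homologous_rel_set n X {} (frag_cmul m z)"
proof -
  let ?G = "relcycle_group n X {}" and ?B = "singular_relboundary_set n X {}"
  interpret N: normal ?B ?G by (rule normal_subgroup_singular_relboundary_relcycle)
  have "(?B #>\<^bsub>?G\<^esub> z) [^]\<^bsub>?G Mod ?B\<^esub> m = ?B #>\<^bsub>?G\<^esub> (z [^]\<^bsub>?G\<^esub> m)"
    using assms by (intro N.FactGroup_int_pow) simp
  moreover have "z [^]\<^bsub>?G\<^esub> m = frag_cmul m z"
  proof -
    have "z \<in> carrier ?G" using assms by simp
    then have "z [^]\<^bsub>?G\<^esub> m = z [^]\<^bsub>chain_group n X\<^esub> m"
      unfolding relcycle_group_def by (rule group.int_pow_subgroup_generated[OF group_chain_group])
    also have "\<dots> = frag_cmul m z"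
      unfolding chain_group_def using assms
      by (intro int_pow_free_Abelian_group) (simp add: singular_cycle singular_chain_def)
    finally show ?thesis .
  qed
  ultimately show ?thesis
    by (simp add: right_coset_singular_relboundary nontrivial_relative_homology_group)
qed

text \<open>An orientation in terms of cycles: every \<open>3\<close>-cycle is homologous to a multiple of a fixed one.\<close>

lemma orientation3_iff:
  "orientation3 X \<mu> \<longleftrightarrow> (\<exists>z. singular_relcycle 3 X {} z \<and> \<mu> = homologous_rel_set 3 X {} z \<and>
     (\<forall>z'. singular_relcycle 3 X {} z' \<longrightarrow> (\<exists>m. homologous_rel 3 X {} z' (frag_cmul m z))))"
proof -
  let ?H = "homology_group 3 X"
  have carrier: "carrier ?H = homologous_rel_set 3 X {} ` singular_relcycle_set 3 X {}"
    using carrier_relative_homology_group[of 3 X "{}"] by simp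
  have "carrier (subgroup_generated ?H {homologous_rel_set 3 X {} z}) = carrier ?H \<longleftrightarrow>
      (\<forall>z'. singular_relcycle 3 X {} z' \<longrightarrow> (\<exists>m. homologous_rel 3 X {} z' (frag_cmul m z)))"
    if z: "singular_relcycle 3 X {} z" for z
  proof -
    have "carrier (subgroup_generated ?H {homologous_rel_set 3 X {} z}) =
        range (\<lambda>m::int. homologous_rel_set 3 X {} z [^]\<^bsub>?H\<^esub> m)"
      using z by (intro group.carrier_subgroup_generated_by_singleton) (auto simp: carrier)
    also have "\<dots> = range (\<lambda>m. homologous_rel_set 3 X {} (frag_cmul m z))"
      using int_pow_homology_group[OF z] by simp
    finally have gen: "carrier (subgroup_generated ?H {homologous_rel_set 3 X {} z}) =
        range (\<lambda>m. homologous_rel_set 3 X {} (frag_cmul m z))" .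
    let ?R = "range (\<lambda>m. homologous_rel_set 3 X {} (frag_cmul m z))"
    have "?R \<subseteq> carrier ?H"
      using z by (auto simp: carrier singular_relcycle_cmul)
    then have "?R = carrier ?H \<longleftrightarrow> carrier ?H \<subseteq> ?R"
      by blast
    also have "\<dots> \<longleftrightarrow> (\<forall>z'. singular_relcycle 3 X {} z' \<longrightarrow>
        (\<exists>m. homologous_rel_set 3 X {} z' = homologous_rel_set 3 X {} (frag_cmul m z)))"
      unfolding carrier by (auto simp: image_subset_iff image_iff)
    finally show ?thesis
      unfolding gen homologous_rel_set_eq .
  qed
  moreover have "\<mu> \<in> carrier ?H \<longleftrightarrow> (\<exists>z. singular_relcycle 3 X {} z \<and> \<mu> = homologous_rel_set 3 X {} z)"
    unfolding carrier by (simp only: image_iff bex_simps mem_Collect_eq Bex_def)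
  ultimately show ?thesis
    unfolding orientation3_def by metis
qed

lemma chain_eval_homologous:
  assumes "f \<in> cocycles (singular_cochains X) n" "homologous_rel n X {} a b"
  shows "chain_eval (f n) a = chain_eval (f n) b"
  using chain_eval_cocycle_boundary[OF assms(1), of "a - b"] assms(2)
  by (simp add: homologous_rel_def chain_eval_diff)

text \<open>
  A space whose third rational cohomology is a line, with a spanning class \<open>\<omega>\<close>; uniqueness of
  the coefficient makes \<open>\<omega>\<close> nonzero.
\<close>

locale rational_cohomology_line =
  fixes X :: "'x topology" and \<omega> :: "(nat \<Rightarrow> ((nat \<Rightarrow> real) \<Rightarrow> 'x) \<Rightarrow> rat) set"
  assumes \<omega>: "\<omega> \<in> cohomology (singular_cochains X) 3"
    and multiples: "g \<in> cohomology (singular_cochains X) 3 \<Longrightarrow>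
      \<exists>!r. g = class_scale (singular_cochains X) 3 r \<omega>"
begin

abbreviation C where "C \<equiv> singular_cochains X"

sublocale cochain_complex C
  by (rule cochain_complex_singular_cochains)

lemma class_scale_eq_iff: "class_scale C 3 r \<omega> = class_scale C 3 s \<omega> \<longleftrightarrow> r = s"
  using multiples[OF class_scale_in_cohomology[OF \<omega>]] by blast

lemma representative:
  obtains f where "f \<in> cocycles C 3" "\<omega> = cohomology_class C 3 f"
  using \<omega> by (auto simp: cohomology_def)

lemma kronecker_class_scale:
  assumes "orientation3 X \<mu>"
  shows "kronecker 3 (class_scale C 3 r \<omega>) \<mu> = r * kronecker 3 \<omega> \<mu>"
proof -
  obtain z where z: "singular_relcycle 3 X {} z" "\<mu> = homologous_rel_set 3 X {} z"
    using assms by (auto simp: orientation3_iff)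
  obtain f where f: "f \<in> cocycles C 3" "\<omega> = cohomology_class C 3 f"
    by (rule representative)
  have "scale C r f \<in> cocycles C 3"
    using f(1) subspace_scale[OF subspace_cocycles] by blast
  moreover have "scale C r f 3 = (\<lambda>\<sigma>. r * f 3 \<sigma>)"
    by (simp add: singular_cochains_def)
  ultimately show ?thesis
    using f z by (simp add: class_scale_cohomology_class kronecker_eq_chain_eval chain_eval_scale_cochain)
qed

lemma kronecker_nonzero:
  assumes "orientation3 X \<mu>"
  shows "kronecker 3 \<omega> \<mu> \<noteq> 0"
proof
  assume 0: "kronecker 3 \<omega> \<mu> = 0"
  obtain z where z: "singular_relcycle 3 X {} z" "\<mu> = homologous_rel_set 3 X {} z"
    "\<And>z'. singular_relcycle 3 X {} z' \<Longrightarrow> \<exists>m. homologous_rel 3 X {} z' (frag_cmul m z)"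
    using assms unfolding orientation3_iff by blast
  obtain f where f: "f \<in> cocycles C 3" "\<omega> = cohomology_class C 3 f"
    by (rule representative)
  have fz: "chain_eval (f 3) z = 0"
    using 0 by (simp add: f(2) z(2) kronecker_eq_chain_eval[OF f(1) z(1)])
  have "chain_eval (f 3) z' = 0" if z': "singular_relcycle 3 X {} z'" for z'
  proof -
    obtain m where "homologous_rel 3 X {} z' (frag_cmul m z)"
      using z(3)[OF z'] ..
    from chain_eval_homologous[OF f(1) this] fz show ?thesis
      by (simp add: chain_eval_cmul)
  qed
  then have "f \<in> coboundaries C 3"
    using coboundary_if_vanishes_on_cycles[of f X 2] f(1) by (simp add: cocycles_def)
  then have "\<omega> = class_scale C 3 0 \<omega>"
    by (simp add: f(2) class_scale_cohomology_class cohomology_class_eq_iff)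
  moreover have "\<omega> = class_scale C 3 1 \<omega>"
    by (simp add: f(2) class_scale_cohomology_class)
  ultimately show False
    using class_scale_eq_iff[of 0 1] by simp
qed

lemma dual_class3_eq:
  assumes \<mu>: "orientation3 X \<mu>"
  shows "dual_class3 X \<mu> = class_scale C 3 (1 / kronecker 3 \<omega> \<mu>) \<omega>"
  unfolding dual_class3_def
proof (rule the_equality)
  show "class_scale C 3 (1 / kronecker 3 \<omega> \<mu>) \<omega> \<in> cohomology C 3 \<and>
      kronecker 3 (class_scale C 3 (1 / kronecker 3 \<omega> \<mu>) \<omega>) \<mu> = 1"
    using kronecker_nonzero[OF \<mu>] by (simp add: kronecker_class_scale[OF \<mu>] class_scale_in_cohomology[OF \<omega>])
  fix g assume g: "g \<in> cohomology C 3 \<and> kronecker 3 g \<mu> = 1"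
  then obtain r where r: "g = class_scale C 3 r \<omega>"
    using multiples by blast
  with g have "r * kronecker 3 \<omega> \<mu> = 1"
    by (simp add: kronecker_class_scale[OF \<mu>])
  then have "r = 1 / kronecker 3 \<omega> \<mu>"
    using kronecker_nonzero[OF \<mu>] by (simp add: field_simps)
  with r show "g = class_scale C 3 (1 / kronecker 3 \<omega> \<mu>) \<omega>" by simp
qed

lemma positive_multiple_dual_class3_iff:
  assumes \<mu>: "orientation3 X \<mu>" and "s > 0"
  shows "(\<exists>r>0. class_scale C 3 s \<omega> = class_scale C 3 r (dual_class3 X \<mu>)) \<longleftrightarrow> kronecker 3 \<omega> \<mu> > 0"
proof -
  have "class_scale C 3 s \<omega> = class_scale C 3 r (dual_class3 X \<mu>) \<longleftrightarrow> r = s * kronecker 3 \<omega> \<mu>" for r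
    using kronecker_nonzero[OF \<mu>]
    by (simp add: dual_class3_eq[OF \<mu>] class_scale_class_scale[OF \<omega>] class_scale_eq_iff field_simps eq_commute[of r])
  with \<open>s > 0\<close> show ?thesis by (simp add: zero_less_mult_iff)
qed

text \<open>
  Two generators are integral multiples of each other. As \<open>\<omega>\<close> takes positive values on both, the
  product of the two factors is \<open>1\<close> and they are positive, so that both are \<open>1\<close>.
\<close>

lemma positive_orientation_unique:
  assumes \<mu>: "orientation3 X \<mu>" "kronecker 3 \<omega> \<mu> > 0"
    and \<mu>': "orientation3 X \<mu>'" "kronecker 3 \<omega> \<mu>' > 0"
  shows "\<mu> = \<mu>'"
proof -
  obtain z where z: "singular_relcycle 3 X {} z" "\<mu> = homologous_rel_set 3 X {} z"
    "\<And>z'. singular_relcycle 3 X {} z' \<Longrightarrow> \<exists>m. homologous_rel 3 X {} z' (frag_cmul m z)"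
    using \<mu>(1) unfolding orientation3_iff by blast
  obtain z' where z': "singular_relcycle 3 X {} z'" "\<mu>' = homologous_rel_set 3 X {} z'"
    "\<And>z. singular_relcycle 3 X {} z \<Longrightarrow> \<exists>m. homologous_rel 3 X {} z (frag_cmul m z')"
    using \<mu>'(1) unfolding orientation3_iff by blast
  obtain m n where m: "homologous_rel 3 X {} z' (frag_cmul m z)"
    and n: "homologous_rel 3 X {} z (frag_cmul n z')"
    using z(3)[OF z'(1)] z'(3)[OF z(1)] by blast
  obtain f where f: "f \<in> cocycles C 3" "\<omega> = cohomology_class C 3 f"
    by (rule representative)
  have pos: "chain_eval (f 3) z > 0" "chain_eval (f 3) z' > 0"
    using \<mu>(2) \<mu>'(2) f z z' by (simp_all add: kronecker_eq_chain_eval)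
  have eq_m: "chain_eval (f 3) z' = of_int m * chain_eval (f 3) z"
    using chain_eval_homologous[OF f(1) m] by (simp add: chain_eval_cmul)
  have eq_n: "chain_eval (f 3) z = of_int n * chain_eval (f 3) z'"
    using chain_eval_homologous[OF f(1) n] by (simp add: chain_eval_cmul)
  have "of_int m * chain_eval (f 3) z > 0"
    using pos(2) unfolding eq_m .
  with pos(1) have "m > 0"
    by (simp add: zero_less_mult_iff)
  have "chain_eval (f 3) z = of_int (m * n) * chain_eval (f 3) z"
    using eq_n unfolding eq_m by (simp add: mult_ac)
  with pos(1) have "rat_of_int (m * n) = 1"
    by simp
  then have "m * n = 1"
    by (simp only: of_int_eq_1_iff)
  with \<open>m > 0\<close> have "m = 1"
    by (simp add: pos_zmult_eq_1_iff)
  with m have "homologous_rel 3 X {} z' z" by simp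
  then show ?thesis
    by (metis z(2) z'(2) homologous_rel_set_eq)
qed

lemma positive_orientation_exists:
  assumes "orientation3 X \<mu>"
  shows "\<exists>\<mu>. orientation3 X \<mu> \<and> kronecker 3 \<omega> \<mu> > 0"
proof (cases "kronecker 3 \<omega> \<mu> > 0")
  case True
  with assms show ?thesis by blast
next
  case False
  with kronecker_nonzero[OF assms] have neg: "kronecker 3 \<omega> \<mu> < 0" by linarith
  obtain z where z: "singular_relcycle 3 X {} z" "\<mu> = homologous_rel_set 3 X {} z"
    "\<And>z'. singular_relcycle 3 X {} z' \<Longrightarrow> \<exists>m. homologous_rel 3 X {} z' (frag_cmul m z)"
    using assms unfolding orientation3_iff by blast
  have z': "singular_relcycle 3 X {} (- z)"
    using z(1) by (simp add: singular_relcycle_minus)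
  have "\<exists>m. homologous_rel 3 X {} c (frag_cmul m (- z))" if c: "singular_relcycle 3 X {} c" for c
  proof -
    obtain m where "homologous_rel 3 X {} c (frag_cmul m z)"
      using z(3)[OF c] ..
    moreover have "frag_cmul (- m) (- z) = frag_cmul m z"
      by (metis frag_cmul_cmul frag_cmul_minus_one mult_minus1_right minus_minus)
    ultimately show ?thesis by metis
  qed
  then have "orientation3 X (homologous_rel_set 3 X {} (- z))"
    unfolding orientation3_iff using z' by blast
  moreover obtain f where f: "f \<in> cocycles C 3" "\<omega> = cohomology_class C 3 f"
    by (rule representative)
  moreover have "chain_eval (f 3) (- z) = - chain_eval (f 3) z"
    using chain_eval_diff[of "f 3" 0 z] by simp
  ultimately show ?thesis
    using neg z z' by (intro exI[of _ "homologous_rel_set 3 X {} (- z)"]) (simp add: kronecker_eq_chain_eval)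
qed

end

section \<open>Cocycles of the minimal model in degrees one and three\<close>

(* The simplifier would otherwise turn the degree 1 into Suc 0, and facts stated for degree 1
   would no longer match. *)
declare One_nat_def [simp del]

interpretation model: cochain_complex heis_model
  by (rule is_dga_imp_cochain_complex[OF is_dga_heis_model])

interpretation cochains: cochain_complex heis_cochains
  by (rule cochain_complex_singular_cochains)

text \<open>The \<open>1\<close>-cocycle \<open>p x + q y\<close> of the model.\<close>

definition xy_combination :: "rat \<Rightarrow> rat \<Rightarrow> heis_gen set \<Rightarrow> rat" where
  "xy_combination p q = scale heis_model p model_x + scale heis_model q model_y"

abbreviation (input) model_xyw :: "heis_gen set \<Rightarrow> rat" where
  "model_xyw \<equiv> model_x \<and>\<^sub>m model_y \<and>\<^sub>m model_w"

lemma component_heis_model_iff: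
  "a \<in> component heis_model n \<longleftrightarrow> (\<forall>S. card S \<noteq> n \<longrightarrow> a S = 0)"
  by (auto simp: heis_model_def)

lemma heis_model_apply:
  "scale heis_model r a S = r * a S"
  "diff heis_model a S = (if S = {GX, GY} then a {GW} else 0)"
  by (simp_all add: heis_model_def)

lemma xy_combination_apply:
  "xy_combination p q S = (if S = {GX} then p else if S = {GY} then q else 0)"
  by (simp add: xy_combination_def heis_model_def monomial_def)

lemma xy_combination_eq_iff: "xy_combination p q = xy_combination p' q' \<longleftrightarrow> p = p' \<and> q = q'"
  unfolding heis_elt_eq_iff heis_gen_all_sets by (simp add: xy_combination_apply insert_eq_iff doubleton_eq_iff)

lemma xy_combination_add_scale:
  "scale heis_model r (xy_combination a b) + scale heis_model s (xy_combination c d) =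
    xy_combination (r * a + s * c) (r * b + s * d)"
  unfolding fun_eq_iff by (simp add: xy_combination_apply) (simp add: heis_model_def xy_combination_apply)

lemma cocycles_heis_model_1: "cocycles heis_model 1 = {xy_combination p q | p q. True}"
proof -
  have "z \<in> cocycles heis_model 1 \<longleftrightarrow> (\<exists>p q. z = xy_combination p q)" for z
  proof
    assume z: "z \<in> cocycles heis_model 1"
    then have "diff heis_model z {GX, GY} = 0" and comp: "\<And>S. card S \<noteq> 1 \<Longrightarrow> z S = 0"
      by (auto simp: cocycles_def component_heis_model_iff)
    then have "z {GW} = 0" by (simp add: heis_model_def)
    then have "z = xy_combination (z {GX}) (z {GY})"
      unfolding heis_elt_eq_iff heis_gen_all_sets
      by (simp add: xy_combination_apply comp insert_eq_iff doubleton_eq_iff)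
    then show "\<exists>p q. z = xy_combination p q" by blast
  next
    assume "\<exists>p q. z = xy_combination p q"
    then show "z \<in> cocycles heis_model 1"
      by (auto simp: cocycles_def component_heis_model_iff xy_combination_apply heis_model_apply
          heis_elt_eq_iff)
  qed
  then show ?thesis by blast
qed

lemma coboundaries_heis_model_1: "coboundaries heis_model 1 = {0}"
proof -
  have "diff heis_model a = 0" if "a \<in> component heis_model 0" for a
  proof -
    have "a {GW} = 0"
      using that unfolding component_heis_model_iff by (metis One_nat_def card_1_singleton_iff zero_neq_one)
    then show ?thesis by (simp add: heis_model_def fun_eq_iff)
  qed
  moreover have "0 \<in> component heis_model 0"
    by (simp add: component_heis_model_iff)
  ultimately show ?thesis by (force simp: coboundaries_def)
qed

lemma model_xyw_eq: "model_xyw = monomial {GX, GY, GW}"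
  by (rule heis_model_generators)

lemma top_degree:
  assumes "a \<in> component heis_model 3"
  shows "a = scale heis_model (a {GX, GY, GW}) model_xyw"
proof -
  have "a S = 0" if "card S \<noteq> 3" for S
    using assms that by (simp add: component_heis_model_iff)
  then show ?thesis
    unfolding model_xyw_eq heis_elt_eq_iff heis_gen_all_sets
    by (simp add: heis_model_apply monomial_def insert_eq_iff doubleton_eq_iff)
qed

lemma cocycles_heis_model_3: "cocycles heis_model 3 = range (\<lambda>r. scale heis_model r model_xyw)"
proof -
  have "scale heis_model r model_xyw \<in> cocycles heis_model 3" for r
    unfolding model_xyw_eq
    by (auto simp: cocycles_def component_heis_model_iff heis_model_apply monomial_def heis_elt_eq_iff)
  then show ?thesis
    using top_degree by (auto simp: cocycles_def)
qed

lemma coboundaries_heis_model_3: "coboundaries heis_model 3 = {0}"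
proof -
  have "diff heis_model a = 0" if "a \<in> component heis_model 2" for a
  proof -
    have "a {GW} = 0"
      using that unfolding component_heis_model_iff by simp
    then show ?thesis by (simp add: heis_model_def fun_eq_iff)
  qed
  moreover have "0 \<in> component heis_model 2"
    by (simp add: component_heis_model_iff)
  ultimately show ?thesis by (force simp: coboundaries_def)
qed

lemma model_xyw_nonzero: "model_xyw \<noteq> 0"
  unfolding model_xyw_eq by (auto simp: monomial_def fun_eq_iff)

lemma diff_eq_wedge_xy_combination_iff:
  assumes "w \<in> component heis_model 1"
  shows "diff heis_model w = xy_combination a b \<and>\<^sub>m xy_combination c d \<longleftrightarrow>
    w {GW} = a * d - b * c"
  unfolding heis_elt_eq_iff heis_gen_all_sets
  by (simp add: heis_model_simps xy_combination_apply)

text \<open>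
  The determinant enters twice: in the product of the two cocycles and in the coefficient of \<open>w\<close>
  in its primitive.
\<close>

lemma wedge_xy_combination_primitive:
  assumes w: "w \<in> component heis_model 1"
    and dw: "diff heis_model w = xy_combination a b \<and>\<^sub>m xy_combination c d"
  shows "xy_combination a b \<and>\<^sub>m xy_combination c d \<and>\<^sub>m w =
    scale heis_model ((a * d - b * c)\<^sup>2) model_xyw"
proof -
  have "xy_combination p q \<in> component heis_model 1" for p q
    by (simp add: component_heis_model_iff xy_combination_apply)
  then have "xy_combination a b \<and>\<^sub>m xy_combination c d \<and>\<^sub>m w \<in> component heis_model (1 + (1 + 1))"
    using w by (intro heis_model_mult_component)
  also have "1 + (1 + 1) = (3::nat)" by simp
  finally have "xy_combination a b \<and>\<^sub>m xy_combination c d \<and>\<^sub>m w \<in> component heis_model 3" .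
  moreover have "(xy_combination a b \<and>\<^sub>m xy_combination c d \<and>\<^sub>m w) {GX, GY, GW} =
      (a * d - b * c) * w {GW}"
    by (simp add: heis_model_simps xy_combination_apply)
  moreover have "w {GW} = a * d - b * c"
    using dw by (simp add: diff_eq_wedge_xy_combination_iff[OF w])
  ultimately show ?thesis
    using top_degree by (metis power2_eq_square)
qed

section \<open>The identification of the cohomology of the model with that of the manifold\<close>

text \<open>A fixed identification \<open>\<Phi>\<close> of the cohomology of the model with that of the manifold.\<close>

locale heis_identification =
  fixes E :: "'e::ab_group_add dga" and k j \<Phi>
  assumes ident: "model_identification E k j \<Phi>"
begin

sublocale k: cochain_map heis_model E k
  by (intro cochain_map.intro cochain_map_axioms.intro is_dga_imp_cochain_complex is_dga_heis_model)
    (use ident in \<open>auto simp: model_identification_def quasi_iso_def\<close>)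

sublocale j: cochain_map heis_cochains E j
  by (intro cochain_map.intro cochain_map_axioms.intro is_dga_imp_cochain_complex
      cochain_complex_singular_cochains)
    (use ident in \<open>auto simp: model_identification_def quasi_iso_def\<close>)

lemma bij_k: "bij_betw (cohomology_map E k n) (cohomology heis_model n) (cohomology E n)"
  and bij_j: "bij_betw (cohomology_map E j n) (cohomology heis_cochains n) (cohomology E n)"
  using ident by (auto simp: model_identification_def quasi_iso_def)

lemma \<Phi>_in_cohomology: "u \<in> cohomology heis_model n \<Longrightarrow> \<Phi> n u \<in> cohomology heis_cochains n"
  and j_\<Phi>: "u \<in> cohomology heis_model n \<Longrightarrow>
    cohomology_map E j n (\<Phi> n u) = cohomology_map E k n u"
  using ident by (auto simp: model_identification_def)

lemma \<Phi>_eqI: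
  assumes "u \<in> cohomology heis_model n" "v \<in> cohomology heis_cochains n"
    and "cohomology_map E j n v = cohomology_map E k n u"
  shows "\<Phi> n u = v"
  using assms bij_j \<Phi>_in_cohomology j_\<Phi> by (metis bij_betw_imp_inj_on inj_onD)

lemma \<Phi>_inj:
  assumes "u \<in> cohomology heis_model n" "v \<in> cohomology heis_model n"
  shows "\<Phi> n u = \<Phi> n v \<longleftrightarrow> u = v"
  using assms bij_k j_\<Phi> by (metis bij_betw_imp_inj_on inj_onD)

lemma \<Phi>_surj:
  assumes "v \<in> cohomology heis_cochains n"
  obtains z where "z \<in> cocycles heis_model n" "v = \<Phi> n (cohomology_class heis_model n z)"
proof -
  have "cohomology_map E j n v \<in> cohomology E n"
    using bij_j assms by (metis bij_betwE)
  then obtain u where u: "u \<in> cohomology heis_model n" "cohomology_map E k n u = cohomology_map E j n v"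
    using bij_k by (metis bij_betw_imp_surj_on imageE)
  then have "v = \<Phi> n u"
    using assms by (metis \<Phi>_eqI)
  with u(1) that show ?thesis by (auto simp: cohomology_def)
qed

lemma \<Phi>_add:
  assumes u: "u \<in> cohomology heis_model n" and v: "v \<in> cohomology heis_model n"
  shows "\<Phi> n (class_add heis_model n u v) = class_add heis_cochains n (\<Phi> n u) (\<Phi> n v)"
  by (rule \<Phi>_eqI) (simp_all add: u v \<Phi>_in_cohomology model.class_add_in_cohomology
      cochains.class_add_in_cohomology k.cohomology_map_add j.cohomology_map_add j_\<Phi>)

lemma \<Phi>_scale:
  assumes u: "u \<in> cohomology heis_model n"
  shows "\<Phi> n (class_scale heis_model n r u) = class_scale heis_cochains n r (\<Phi> n u)"
  by (rule \<Phi>_eqI) (simp_all add: u \<Phi>_in_cohomology model.class_scale_in_cohomology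
      cochains.class_scale_in_cohomology k.cohomology_map_scale j.cohomology_map_scale j_\<Phi>)

text \<open>The class in \<open>H\<^sup>1(M; \<rat>)\<close> with coordinates \<open>p\<close>, \<open>q\<close>.\<close>

definition xy_class :: "rat \<Rightarrow> rat \<Rightarrow> manifold_class" where
  "xy_class p q = \<Phi> 1 (cohomology_class heis_model 1 (xy_combination p q))"

text \<open>The image in \<open>H\<^sup>3(M; \<rat>)\<close> of the class of \<open>x \<and> y \<and> w\<close>.\<close>

definition \<omega> :: manifold_class where
  "\<omega> = \<Phi> 3 (cohomology_class heis_model 3 model_xyw)"

lemma class_in_cohomology:
  "z \<in> cocycles heis_model n \<Longrightarrow> cohomology_class heis_model n z \<in> cohomology heis_model n"
  by (simp add: cohomology_def)

lemma xy_combination_cocycle: "xy_combination p q \<in> cocycles heis_model 1"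
  unfolding cocycles_heis_model_1 by blast

lemma \<Phi>_1_eq_iff:
  assumes "z \<in> cocycles heis_model 1" "z' \<in> cocycles heis_model 1"
  shows "\<Phi> 1 (cohomology_class heis_model 1 z) = \<Phi> 1 (cohomology_class heis_model 1 z') \<longleftrightarrow> z = z'"
  using assms
  by (simp add: \<Phi>_inj class_in_cohomology model.cohomology_class_eq_iff coboundaries_heis_model_1)

lemma xy_class_eq_iff: "xy_class p q = xy_class p' q' \<longleftrightarrow> p = p' \<and> q = q'"
  by (simp add: xy_class_def \<Phi>_1_eq_iff xy_combination_cocycle xy_combination_eq_iff)

lemma xy_class_add_scale:
  "class_add heis_cochains 1 (class_scale heis_cochains 1 r (xy_class a b))
      (class_scale heis_cochains 1 s (xy_class c d)) = xy_class (r * a + s * c) (r * b + s * d)"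
proof -
  let ?h = "\<lambda>a b. cohomology_class heis_model 1 (xy_combination a b)"
  have h: "?h a b \<in> cohomology heis_model 1" for a b
    by (intro class_in_cohomology xy_combination_cocycle)
  have "xy_class (r * a + s * c) (r * b + s * d) =
      \<Phi> 1 (class_add heis_model 1 (class_scale heis_model 1 r (?h a b)) (class_scale heis_model 1 s (?h c d)))"
    by (simp add: xy_class_def model.class_add_cohomology_class model.class_scale_cohomology_class
        xy_combination_add_scale)
  then show ?thesis
    by (simp add: \<Phi>_add \<Phi>_scale h model.class_scale_in_cohomology xy_class_def)
qed

lemma cohomology_1_iff: "u \<in> cohomology heis_cochains 1 \<longleftrightarrow> (\<exists>p q. u = xy_class p q)"
proof
  assume "u \<in> cohomology heis_cochains 1"
  then obtain z where "z \<in> cocycles heis_model 1" "u = \<Phi> 1 (cohomology_class heis_model 1 z)"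
    by (rule \<Phi>_surj)
  then show "\<exists>p q. u = xy_class p q"
    by (auto simp: cocycles_heis_model_1 xy_class_def)
next
  assume "\<exists>p q. u = xy_class p q"
  then show "u \<in> cohomology heis_cochains 1"
    by (auto simp: xy_class_def intro!: \<Phi>_in_cohomology class_in_cohomology xy_combination_cocycle)
qed

lemma class_basis2_xy_class_iff:
  "class_basis2 heis_cochains 1 (xy_class a b) (xy_class c d) \<longleftrightarrow> a * d - b * c \<noteq> 0"
proof
  let ?comb = "\<lambda>r s. class_add heis_cochains 1 (class_scale heis_cochains 1 r (xy_class a b))
      (class_scale heis_cochains 1 s (xy_class c d))"
  assume basis: "class_basis2 heis_cochains 1 (xy_class a b) (xy_class c d)"
  have zero: "xy_class 0 0 \<in> cohomology heis_cochains 1"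
    unfolding cohomology_1_iff by blast
  from basis have "\<forall>w\<in>cohomology heis_cochains 1. \<exists>!(r, s). w = ?comb r s"
    unfolding class_basis2_def by (elim conjE)
  from bspec[OF this zero] have "\<exists>!(r, s). xy_class 0 0 = ?comb r s" .
  then obtain t where t: "\<And>u. (case u of (r, s) \<Rightarrow> xy_class 0 0 = ?comb r s) \<Longrightarrow> u = t"
    by (rule ex1E) blast
  have indep: "r = 0 \<and> s = 0" if "r * a + s * c = 0" "r * b + s * d = 0" for r s
    using t[of "(r, s)"] t[of "(0, 0)"] that by (simp add: xy_class_add_scale)
  show "a * d - b * c \<noteq> 0"
  proof
    assume det: "a * d - b * c = 0"
    \<comment> \<open>If the determinant vanishes, the rows satisfy the relations with coefficients \<open>(c, -a)\<close> and \<open>(d, -b)\<close>.\<close>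
    have "c = 0 \<and> - a = 0" "d = 0 \<and> - b = 0"
      using det by (intro indep; simp add: algebra_simps)+
    with indep[of 1 1] show False by simp
  qed
next
  assume det: "a * d - b * c \<noteq> 0"
  have "\<exists>!(r, s). w = class_add heis_cochains 1 (class_scale heis_cochains 1 r (xy_class a b))
      (class_scale heis_cochains 1 s (xy_class c d))"
    if w: "w \<in> cohomology heis_cochains 1" for w
  proof -
    obtain p q where pq: "w = xy_class p q"
      using w by (auto simp: cohomology_1_iff)
    define \<Delta> where "\<Delta> = a * d - b * c"
    \<comment> \<open>Cramer's rule.\<close>
    have solve: "p = r * a + s * c \<and> q = r * b + s * d \<longleftrightarrow>
        r = (p * d - q * c) / \<Delta> \<and> s = (q * a - p * b) / \<Delta>" for r s
    proof
      assume "p = r * a + s * c \<and> q = r * b + s * d"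
      then have "p * d - q * c = r * \<Delta>" "q * a - p * b = s * \<Delta>"
        by (auto simp: \<Delta>_def algebra_simps)
      with det show "r = (p * d - q * c) / \<Delta> \<and> s = (q * a - p * b) / \<Delta>"
        by (simp add: \<Delta>_def)
    next
      assume rs: "r = (p * d - q * c) / \<Delta> \<and> s = (q * a - p * b) / \<Delta>"
      have \<Delta>: "\<Delta> \<noteq> 0" using det by (simp add: \<Delta>_def)
      have "r * a + s * c = ((p * d - q * c) * a + (q * a - p * b) * c) / \<Delta>"
        "r * b + s * d = ((p * d - q * c) * b + (q * a - p * b) * d) / \<Delta>"
        using rs by (simp_all add: add_divide_distrib)
      moreover have "(p * d - q * c) * a + (q * a - p * b) * c = p * \<Delta>"
        "(p * d - q * c) * b + (q * a - p * b) * d = q * \<Delta>"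
        by (simp_all add: \<Delta>_def algebra_simps)
      ultimately show "p = r * a + s * c \<and> q = r * b + s * d"
        using \<Delta> by simp
    qed
    show ?thesis
      unfolding pq xy_class_add_scale xy_class_eq_iff solve
      by (rule ex1I[of _ "((p * d - q * c) / \<Delta>, (q * a - p * b) / \<Delta>)"]) auto
  qed
  moreover have "xy_class p q \<in> cohomology heis_cochains 1" for p q
    unfolding cohomology_1_iff by blast
  ultimately show "class_basis2 heis_cochains 1 (xy_class a b) (xy_class c d)"
    unfolding class_basis2_def by (intro conjI ballI)
qed

lemma model_xyw_cocycle: "model_xyw \<in> cocycles heis_model 3"
  using top_degree[of model_xyw] unfolding cocycles_heis_model_3
  by (metis model.scale_one rangeI)

sublocale rational_cohomology_line heis_manifold \<omega>
proof
  let ?t = "cohomology_class heis_model 3 model_xyw"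
  have t: "?t \<in> cohomology heis_model 3"
    by (intro class_in_cohomology model_xyw_cocycle)
  show "\<omega> \<in> cohomology heis_cochains 3"
    unfolding \<omega>_def using t by (rule \<Phi>_in_cohomology)
  have scale: "class_scale heis_cochains 3 r \<omega> =
      \<Phi> 3 (cohomology_class heis_model 3 (scale heis_model r model_xyw))" for r
    unfolding \<omega>_def by (simp add: t model.class_scale_cohomology_class flip: \<Phi>_scale)
  have cocycle: "scale heis_model r model_xyw \<in> cocycles heis_model 3" for r
    unfolding cocycles_heis_model_3 by blast
  have "class_scale heis_cochains 3 r \<omega> = class_scale heis_cochains 3 s \<omega> \<longleftrightarrow> r = s" for r s
    unfolding scale
    by (simp add: \<Phi>_inj class_in_cohomology cocycle model.cohomology_class_eq_iff
        coboundaries_heis_model_3 model_xyw_nonzero)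
  moreover fix g assume "g \<in> cohomology heis_cochains 3"
  then obtain z where "z \<in> cocycles heis_model 3" "g = \<Phi> 3 (cohomology_class heis_model 3 z)"
    by (rule \<Phi>_surj)
  then have "\<exists>r. g = class_scale heis_cochains 3 r \<omega>"
    by (auto simp: cocycles_heis_model_3 scale)
  ultimately show "\<exists>!r. g = class_scale heis_cochains 3 r \<omega>"
    by blast
qed

lemma class_scale_\<omega>:
  "class_scale heis_cochains 3 r \<omega> =
    \<Phi> 3 (cohomology_class heis_model 3 (scale heis_model r model_xyw))"
  unfolding \<omega>_def
  by (simp add: class_in_cohomology model_xyw_cocycle model.class_scale_cohomology_class flip: \<Phi>_scale)

lemma pairing_value_iff:
  "pairing_value \<Phi> (xy_class a b) (xy_class c d) v \<longleftrightarrow>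
    v = class_scale heis_cochains 3 ((a * d - b * c)\<^sup>2) \<omega>"
proof
  assume "pairing_value \<Phi> (xy_class a b) (xy_class c d) v"
  then obtain p q w where *: "p \<in> cocycles heis_model 1" "q \<in> cocycles heis_model 1"
      "w \<in> component heis_model 1"
      "\<Phi> 1 (cohomology_class heis_model 1 p) = xy_class a b"
      "\<Phi> 1 (cohomology_class heis_model 1 q) = xy_class c d"
      "diff heis_model w = p \<and>\<^sub>m q"
      "v = \<Phi> 3 (cohomology_class heis_model 3 (p \<and>\<^sub>m q \<and>\<^sub>m w))"
    unfolding pairing_value_def by blast
  then have "p = xy_combination a b" "q = xy_combination c d"
    by (simp_all add: xy_class_def \<Phi>_1_eq_iff xy_combination_cocycle)
  with * show "v = class_scale heis_cochains 3 ((a * d - b * c)\<^sup>2) \<omega>"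
    by (simp add: class_scale_\<omega> wedge_xy_combination_primitive)
next
  define w where "w = scale heis_model (a * d - b * c) model_w"
  have w: "w \<in> component heis_model 1"
    by (simp add: w_def component_heis_model_iff) (simp add: heis_model_def monomial_def)
  have "w {GW} = a * d - b * c"
    by (simp add: w_def heis_model_def monomial_def)
  then have dw: "diff heis_model w = xy_combination a b \<and>\<^sub>m xy_combination c d"
    by (simp add: diff_eq_wedge_xy_combination_iff[OF w])
  assume "v = class_scale heis_cochains 3 ((a * d - b * c)\<^sup>2) \<omega>"
  then have "v = \<Phi> 3 (cohomology_class heis_model 3
      (xy_combination a b \<and>\<^sub>m xy_combination c d \<and>\<^sub>m w))"
    by (simp add: class_scale_\<omega> wedge_xy_combination_primitive[OF w dw])
  with w dw show "pairing_value \<Phi> (xy_class a b) (xy_class c d) v"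
    unfolding pairing_value_def xy_class_def using xy_combination_cocycle by blast
qed

lemma pairing_xy_class:
  "pairing \<Phi> (xy_class a b) (xy_class c d) = class_scale heis_cochains 3 ((a * d - b * c)\<^sup>2) \<omega>"
  unfolding pairing_def pairing_value_iff by (rule the_equality) simp_all

lemma class_scale_one_\<omega>: "class_scale heis_cochains 3 1 \<omega> = \<omega>"
  unfolding class_scale_\<omega> model.scale_one by (rule \<omega>_def[symmetric])

lemma canonical_orientation_iff:
  assumes "orientation3 heis_manifold \<mu>"
  shows "orientation3 heis_manifold (canonical_orientation \<Phi>)"
    and "\<mu> = canonical_orientation \<Phi> \<longleftrightarrow> kronecker 3 \<omega> \<mu> > 0"
proof -
  let ?P = "\<lambda>\<mu>. orientation3 heis_manifold \<mu> \<and> kronecker 3 \<omega> \<mu> > 0"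
  have pos: "(\<exists>r>0. \<omega> = class_scale heis_cochains 3 r (dual_class3 heis_manifold \<mu>)) \<longleftrightarrow>
      kronecker 3 \<omega> \<mu> > 0" if "orientation3 heis_manifold \<mu>" for \<mu>
    using positive_multiple_dual_class3_iff[OF that, of 1] by (simp add: class_scale_one_\<omega>)
  have "canonical_orientation \<Phi> = (THE \<mu>. ?P \<mu>)"
    unfolding canonical_orientation_def \<omega>_def[symmetric] using pos by metis
  moreover have "\<exists>!\<mu>. ?P \<mu>"
    using positive_orientation_exists[OF assms] positive_orientation_unique by blast
  ultimately have "?P (canonical_orientation \<Phi>)"
    by (metis (mono_tags, lifting) theI')
  with assms positive_orientation_unique
  show "orientation3 heis_manifold (canonical_orientation \<Phi>)"
    and "\<mu> = canonical_orientation \<Phi> \<longleftrightarrow> kronecker 3 \<omega> \<mu> > 0"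
    by blast+
qed

end

section \<open>The pairing and the canonical orientation\<close>

theorem mainTheorem1:
  fixes E :: "'e::ab_group_add dga"
    and k :: "(heis_gen set \<Rightarrow> rat) \<Rightarrow> 'e"
    and j :: "(nat \<Rightarrow> ((nat \<Rightarrow> real) \<Rightarrow> (real^3^3) set) \<Rightarrow> rat) \<Rightarrow> 'e"
    and \<Phi> :: "nat \<Rightarrow> heis_class \<Rightarrow> manifold_class"
    and x y :: manifold_class
  assumes ident: "model_identification E k j \<Phi>"
    and x: "x = \<Phi> 1 (cohomology_class heis_model 1 model_x)"
    and y: "y = \<Phi> 1 (cohomology_class heis_model 1 model_y)"
  shows
    "class_basis2 heis_cochains 1 x y \<and>
     (\<forall>x\<^sub>0\<in>cohomology heis_cochains 1. \<forall>y\<^sub>0\<in>cohomology heis_cochains 1.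
        (\<exists>!c. pairing_value \<Phi> x\<^sub>0 y\<^sub>0 c) \<and>
        pairing \<Phi> x\<^sub>0 y\<^sub>0 \<in> cohomology heis_cochains 3) \<and>
     pairing \<Phi> x y = \<Phi> 3 (cohomology_class heis_model 3 (model_x \<and>\<^sub>m model_y \<and>\<^sub>m model_w)) \<and>
     (\<forall>x\<^sub>0\<in>cohomology heis_cochains 1. \<forall>y\<^sub>0\<in>cohomology heis_cochains 1. \<forall>A :: rat^2^2.
        x\<^sub>0 = class_add heis_cochains 1 (class_scale heis_cochains 1 (A$1$1) x)
                                        (class_scale heis_cochains 1 (A$1$2) y) \<and>
        y\<^sub>0 = class_add heis_cochains 1 (class_scale heis_cochains 1 (A$2$1) x)
                                        (class_scale heis_cochains 1 (A$2$2) y) \<longrightarrow>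
        pairing \<Phi> x\<^sub>0 y\<^sub>0 = class_scale heis_cochains 3 ((det A)\<^sup>2) (pairing \<Phi> x y)) \<and>
     ((\<exists>\<mu>. orientation3 heis_manifold \<mu>) \<longrightarrow>
        orientation3 heis_manifold (canonical_orientation \<Phi>)) \<and>
     (\<forall>x\<^sub>0 y\<^sub>0. class_basis2 heis_cochains 1 x\<^sub>0 y\<^sub>0 \<longrightarrow>
        (\<forall>\<mu>. orientation3 heis_manifold \<mu> \<longrightarrow>
           (\<mu> = canonical_orientation \<Phi> \<longleftrightarrow>
            (\<exists>r>0. pairing \<Phi> x\<^sub>0 y\<^sub>0 =
                    class_scale heis_cochains 3 r (dual_class3 heis_manifold \<mu>)))))"
proof -
  interpret heis_identification E k j \<Phi>
    by unfold_locales (rule ident)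
  have x': "x = xy_class 1 0" and y': "y = xy_class 0 1"
    by (simp_all add: x y xy_class_def xy_combination_def)
  have basis: "class_basis2 heis_cochains 1 x y"
    unfolding x' y' class_basis2_xy_class_iff by simp
  have well_defined: "(\<exists>!c. pairing_value \<Phi> x\<^sub>0 y\<^sub>0 c) \<and> pairing \<Phi> x\<^sub>0 y\<^sub>0 \<in> cohomology heis_cochains 3"
    if xy0: "x\<^sub>0 \<in> cohomology heis_cochains 1" "y\<^sub>0 \<in> cohomology heis_cochains 1" for x\<^sub>0 y\<^sub>0
  proof -
    obtain a b c d where "x\<^sub>0 = xy_class a b" "y\<^sub>0 = xy_class c d"
      using xy0 by (auto simp: cohomology_1_iff)
    then show ?thesis
      by (simp add: pairing_value_iff pairing_xy_class cochains.class_scale_in_cohomology[OF \<omega>])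
  qed
  have xy: "pairing \<Phi> x y = \<omega>"
    by (simp add: x' y' pairing_xy_class class_scale_one_\<omega>)
  have det: "pairing \<Phi> x\<^sub>0 y\<^sub>0 = class_scale heis_cochains 3 ((det A)\<^sup>2) (pairing \<Phi> x y)"
    if "x\<^sub>0 = class_add heis_cochains 1 (class_scale heis_cochains 1 (A$1$1) x)
                                        (class_scale heis_cochains 1 (A$1$2) y)"
      and "y\<^sub>0 = class_add heis_cochains 1 (class_scale heis_cochains 1 (A$2$1) x)
                                        (class_scale heis_cochains 1 (A$2$2) y)"
    for x\<^sub>0 y\<^sub>0 and A :: "rat^2^2"
    unfolding that xy unfolding x' y' xy_class_add_scale pairing_xy_class det_2 by simp
  have orientation: "\<mu> = canonical_orientation \<Phi> \<longleftrightarrow>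
      (\<exists>r>0. pairing \<Phi> x\<^sub>0 y\<^sub>0 = class_scale heis_cochains 3 r (dual_class3 heis_manifold \<mu>))"
    if basis: "class_basis2 heis_cochains 1 x\<^sub>0 y\<^sub>0" and \<mu>: "orientation3 heis_manifold \<mu>" for x\<^sub>0 y\<^sub>0 \<mu>
  proof -
    obtain a b c d where xy0: "x\<^sub>0 = xy_class a b" "y\<^sub>0 = xy_class c d"
      using basis by (auto simp: class_basis2_def cohomology_1_iff)
    with basis have "(a * d - b * c)\<^sup>2 > 0"
      by (simp add: class_basis2_xy_class_iff)
    then show ?thesis
      by (simp add: xy0 pairing_xy_class canonical_orientation_iff(2)[OF \<mu>]
          positive_multiple_dual_class3_iff[OF \<mu>])
  qed
  show ?thesis
  proof (intro conjI ballI allI impI)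
    show "class_basis2 heis_cochains 1 x y"
      by (rule basis)
    show "pairing \<Phi> x y = \<Phi> 3 (cohomology_class heis_model 3 (model_x \<and>\<^sub>m model_y \<and>\<^sub>m model_w))"
      using xy unfolding \<omega>_def .
    show "orientation3 heis_manifold (canonical_orientation \<Phi>)" if "\<exists>\<mu>. orientation3 heis_manifold \<mu>"
      using that canonical_orientation_iff(1) by (elim exE)
    fix x\<^sub>0 y\<^sub>0
    show "\<mu> = canonical_orientation \<Phi> \<longleftrightarrow>
        (\<exists>r>0. pairing \<Phi> x\<^sub>0 y\<^sub>0 = class_scale heis_cochains 3 r (dual_class3 heis_manifold \<mu>))"
      if "class_basis2 heis_cochains 1 x\<^sub>0 y\<^sub>0" "orientation3 heis_manifold \<mu>" for \<mu>
      using that by (rule orientation)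
    assume "x\<^sub>0 \<in> cohomology heis_cochains 1" "y\<^sub>0 \<in> cohomology heis_cochains 1"
    then show "\<exists>!c. pairing_value \<Phi> x\<^sub>0 y\<^sub>0 c" "pairing \<Phi> x\<^sub>0 y\<^sub>0 \<in> cohomology heis_cochains 3"
      by (rule well_defined[THEN conjunct1], rule well_defined[THEN conjunct2])
    show "pairing \<Phi> x\<^sub>0 y\<^sub>0 = class_scale heis_cochains 3 ((det A)\<^sup>2) (pairing \<Phi> x y)"
      if "x\<^sub>0 = class_add heis_cochains 1 (class_scale heis_cochains 1 (A$1$1) x)
                                          (class_scale heis_cochains 1 (A$1$2) y) \<and>
          y\<^sub>0 = class_add heis_cochains 1 (class_scale heis_cochains 1 (A$2$1) x)
                                          (class_scale heis_cochains 1 (A$2$2) y)" for A :: "rat^2^2"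
      using that by (elim conjE) (rule det)
  qed
qed

end
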